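(* Let $s\geq 2$ be an integer and let $\Gamma\in\mathrm{LDT}(s)$ relative to $G$. If $\Gamma$ is nondegenerate, not $G$-basic, and not isomorphic to $K_{m[b]}$ for any $m\geq 3$, $b\geq 2$, then there is a nontrivial normal subgroup $N$ of $G$ such that $\Gamma$ is a cover of the quotient graph $\Gamma_N$, and $\Gamma_N$ lies in $\mathrm{LDT}(s)$ relative to $G/N$ and is $(G/N)$-basic.
   Context: All graphs are finite, simple and undirected, with vertex set $V\Gamma$ and edge set $E\Gamma$. For a connected graph $\Gamma$, $d_\Gamma$ is the path distance, $\mathrm{diam}(\Gamma)$ its maximum value, and $\Gamma_i(v)=\{w\in V\Gamma : d_\Gamma(v,w)=i\}$. For $G\le \mathrm{Aut}(\Gamma)$, $G_v$ is the stabiliser of the vertex $v$ in $G$. A graph $\Gamma$ is locally $(G,s)$-distance transitive, where $G\le\mathrm{Aut}(\Gamma)$, if $s\le \mathrm{diam}(\Gamma)$ and for each vertex $v$ the group $G_v$ acts transitively on $\Gamma_i(v)$ for all $1\le i\le s$ (vacuous when $s=0$ or $\Gamma_i(v)=\emptyset$). For $s\ge1$, $\mathrm{LDT}(s)$ is the set of connected graphs $\Gamma$ that are locally $(G,s')$-distance transitive for some $G\le\mathrm{Aut}(\Gamma)$, where $s'=\min\{s,\mathrm{diam}(\Gamma)\}$; for such $\Gamma$ and $G$ we say $\Gamma\in\mathrm{LDT}(s)$ relative to $G$. For $N$ normal in $G$, the $G$-normal quotient $\Gamma_N$ is the graph whose vertices are the $N$-orbits on $V\Gamma$, two distinct orbits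 $B_1,B_2$ being adjacent iff some $v\in B_1$, $w\in B_2$ are adjacent in $\Gamma$; it is nontrivial if $N\neq1$. Saying that $\Gamma_N\in\mathrm{LDT}(s)$ relative to $G/N$ includes that $G/N$ acts faithfully on the $N$-orbits, so that it is regarded as a subgroup of $\mathrm{Aut}(\Gamma_N)$. The graph $\Gamma$ is a cover of $\Gamma_N$ if $|\Gamma_1(v)\cap B_2|=1$ for each edge $\{B_1,B_2\}$ of $\Gamma_N$ and each $v\in B_1$. A graph in $\mathrm{LDT}(s)$ is degenerate if it is isomorphic to $K_1$, $K_2$ or a star $K_{1,r}$ with $r\ge2$, and nondegenerate otherwise. If $\Gamma\in\mathrm{LDT}(s)$ relative to $G$, then $\Gamma$ is $G$-basic if $\Gamma$ is nondegenerate and $\Gamma_N$ is degenerate for every nontrivial normal subgroup $N$ of $G$. $K_{m[b]}$ denotes the complete $m$-partite graph with all parts of size $b$. *)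

theory Defs
  imports
    "Graph_Theory.Graph_Theory"
    "HOL-Algebra.Group_Action"
    "HOL-Library.Disjoint_Sets"
begin

text \<open>
  A finite simple undirected graph is a \<^locale>\<open>pair_graph\<close>: a finite vertex set together with
  a symmetric, irreflexive set of arcs, each edge being present as two opposite arcs.
  Connected graphs are nonempty.
\<close>

section \<open>Distance\<close>

definition gdist :: "'a pair_pre_digraph \<Rightarrow> 'a \<Rightarrow> 'a \<Rightarrow> nat" where
  "gdist \<Gamma> u v = (LEAST n. \<exists>p. pre_digraph.apath (with_proj \<Gamma>) u p v \<and> length p = n)"

definition diam :: "'a pair_pre_digraph \<Rightarrow> nat" where
  "diam \<Gamma> = Max {gdist \<Gamma> u v | u v. u \<in> pverts \<Gamma> \<and> v \<in> pverts \<Gamma>}"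

definition gsphere :: "'a pair_pre_digraph \<Rightarrow> nat \<Rightarrow> 'a \<Rightarrow> 'a set" where
  "gsphere \<Gamma> i v = {w \<in> pverts \<Gamma>. gdist \<Gamma> v w = i}"

section \<open>Groups of automorphisms\<close>

text \<open>
  Permutations of the vertex set are extensional functions, as in \<^const>\<open>BijGroup\<close>, so that
  distinct group elements differ on some vertex. A group \<open>G\<close> of automorphisms is given by
  its set of elements; \<open>perm_group\<close> turns this set into a group record. Such a group acts
  on vertices by the identity map \<open>\<lambda>g. g\<close>.
\<close>

definition Aut :: "'a pair_pre_digraph \<Rightarrow> ('a \<Rightarrow> 'a) monoid" where
  "Aut \<Gamma> = (BijGroup (pverts \<Gamma>))
     \<lparr>carrier := {f \<in> Bij (pverts \<Gamma>). \<forall>u \<in> pverts \<Gamma>. \<forall>v \<in> pverts \<Gamma>.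
                   (f u, f v) \<in> parcs \<Gamma> \<longleftrightarrow> (u, v) \<in> parcs \<Gamma>}\<rparr>"

definition perm_group :: "'a pair_pre_digraph \<Rightarrow> ('a \<Rightarrow> 'a) set \<Rightarrow> ('a \<Rightarrow> 'a) monoid" where
  "perm_group \<Gamma> G = (BijGroup (pverts \<Gamma>))\<lparr>carrier := G\<rparr>"

definition locally_distance_transitive ::
    "'a pair_pre_digraph \<Rightarrow> ('a \<Rightarrow> 'a) set \<Rightarrow> nat \<Rightarrow> bool" where
  "locally_distance_transitive \<Gamma> G s \<longleftrightarrow>
     subgroup G (Aut \<Gamma>) \<and> s \<le> diam \<Gamma> \<and>
     (\<forall>v \<in> pverts \<Gamma>. \<forall>i \<in> {1..s}. \<forall>x \<in> gsphere \<Gamma> i v. \<forall>y \<in> gsphere \<Gamma> i v.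
        \<exists>g \<in> stabilizer (perm_group \<Gamma> G) (\<lambda>g. g) v. g x = y)"

definition LDT_relative :: "nat \<Rightarrow> 'a pair_pre_digraph \<Rightarrow> ('a \<Rightarrow> 'a) set \<Rightarrow> bool" where
  "LDT_relative s \<Gamma> G \<longleftrightarrow>
     pair_graph \<Gamma> \<and> Digraph_Component.connected (with_proj \<Gamma>) \<and>
     locally_distance_transitive \<Gamma> G (min s (diam \<Gamma>))"

section \<open>Normal quotients and covers\<close>

definition quotient_graph ::
    "'a pair_pre_digraph \<Rightarrow> ('a \<Rightarrow> 'a) set \<Rightarrow> 'a set pair_pre_digraph" where
  "quotient_graph \<Gamma> N =
     (let Bs = orbits (perm_group \<Gamma> N) (pverts \<Gamma>) (\<lambda>g. g)
      in \<lparr>pverts = Bs,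
          parcs = {(B1, B2). B1 \<in> Bs \<and> B2 \<in> Bs \<and> B1 \<noteq> B2 \<and>
                     (\<exists>v \<in> B1. \<exists>w \<in> B2. (v, w) \<in> parcs \<Gamma>)}\<rparr>)"

definition covers_quotient :: "'a pair_pre_digraph \<Rightarrow> ('a \<Rightarrow> 'a) set \<Rightarrow> bool" where
  "covers_quotient \<Gamma> N \<longleftrightarrow>
     (\<forall>(B1, B2) \<in> parcs (quotient_graph \<Gamma> N). \<forall>v \<in> B1. card (gsphere \<Gamma> 1 v \<inter> B2) = 1)"

text \<open>
  The action of \<open>G/N\<close> on the \<open>N\<close>-orbits. For a coset \<open>C = N g\<close> and an \<open>N\<close>-orbit \<open>B\<close>, every
  element of \<open>C\<close> maps \<open>B\<close> onto the orbit \<open>g B\<close>, so the union below is \<open>g B\<close>.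
\<close>

definition quotient_action ::
    "'a pair_pre_digraph \<Rightarrow> ('a \<Rightarrow> 'a) set \<Rightarrow> ('a \<Rightarrow> 'a) set \<Rightarrow> 'a set \<Rightarrow> 'a set" where
  "quotient_action \<Gamma> N C = (\<lambda>B \<in> pverts (quotient_graph \<Gamma> N). \<Union>g \<in> C. g ` B)"

text \<open>The group of permutations of the \<open>N\<close>-orbits induced by \<open>G/N\<close>.\<close>

definition quotient_perms ::
    "'a pair_pre_digraph \<Rightarrow> ('a \<Rightarrow> 'a) set \<Rightarrow> ('a \<Rightarrow> 'a) set \<Rightarrow> ('a set \<Rightarrow> 'a set) set" where
  "quotient_perms \<Gamma> G N = quotient_action \<Gamma> N ` carrier (perm_group \<Gamma> G Mod N)"

definition nontrivial_normal ::
    "'a pair_pre_digraph \<Rightarrow> ('a \<Rightarrow> 'a) set \<Rightarrow> ('a \<Rightarrow> 'a) set \<Rightarrow> bool" where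
  "nontrivial_normal \<Gamma> G N \<longleftrightarrow> N \<lhd> perm_group \<Gamma> G \<and> N \<noteq> {\<one>\<^bsub>perm_group \<Gamma> G\<^esub>}"

section \<open>Degenerate and basic graphs\<close>

definition degenerate :: "'a pair_pre_digraph \<Rightarrow> bool" where
  "degenerate \<Gamma> \<longleftrightarrow>
     complete_digraph 1 (with_proj \<Gamma>) \<or> complete_digraph 2 (with_proj \<Gamma>) \<or>
     (\<exists>r \<ge> 2. complete_bipartite_digraph 1 r (with_proj \<Gamma>))"

text \<open>
  \<open>G_basic\<close> is meant for graphs in \<open>LDT(s)\<close> relative to \<open>G\<close>; its definition does not
  depend on \<open>s\<close>.
\<close>

definition G_basic :: "'a pair_pre_digraph \<Rightarrow> ('a \<Rightarrow> 'a) set \<Rightarrow> bool" where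
  "G_basic \<Gamma> G \<longleftrightarrow>
     \<not> degenerate \<Gamma> \<and>
     (\<forall>N. nontrivial_normal \<Gamma> G N \<longrightarrow> degenerate (quotient_graph \<Gamma> N))"

text \<open>
  \<open>complete_multipartite_graph m b \<Gamma>\<close> says that \<open>\<Gamma>\<close> is isomorphic to \<open>K\<^bsub>m[b]\<^esub>\<close>, in the style of
  \<^const>\<open>complete_digraph\<close> and \<^const>\<open>complete_bipartite_digraph\<close>.
\<close>

definition complete_multipartite_graph :: "nat \<Rightarrow> nat \<Rightarrow> 'a pair_pre_digraph \<Rightarrow> bool" where
  "complete_multipartite_graph m b \<Gamma> \<longleftrightarrow>
     pair_graph \<Gamma> \<and>
     (\<exists>P. partition_on (pverts \<Gamma>) P \<and> card P = m \<and> (\<forall>B \<in> P. card B = b) \<and>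
        parcs \<Gamma> = {(u, v). \<exists>B \<in> P. \<exists>C \<in> P. B \<noteq> C \<and> u \<in> B \<and> v \<in> C})"

end

theory Submission
  imports Defs
begin

text \<open>
  Among the nontrivial normal subgroups of \<open>G\<close> with nondegenerate quotient (there is one, as
  \<open>\<Gamma>\<close> is not basic) let \<open>N\<close> be maximal with respect to inclusion. This choice settles two of the
  four claims. The kernel \<open>K\<close> of the action of \<open>G\<close> on the \<open>N\<close>-orbits contains \<open>N\<close> and has the same
  orbits, so \<open>\<Gamma>\<^sub>K = \<Gamma>\<^sub>N\<close> and \<open>K = N\<close>: the action of \<open>G/N\<close> is faithful. A nontrivial normal subgroup
  of \<open>G/N\<close> has a preimage \<open>M\<close> in \<open>G\<close> that properly contains \<open>N\<close>, and its quotient of \<open>\<Gamma>\<^sub>N\<close> is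
  isomorphic to \<open>\<Gamma>\<^sub>M\<close>, which is degenerate: \<open>\<Gamma>\<^sub>N\<close> is basic
  (\<open>quotient_graph_kernel\<close>, \<open>preimage_normal\<close>).

  That \<open>\<Gamma>\<^sub>N\<close> is again locally distance transitive holds for every normal subgroup. A walk in \<open>\<Gamma>\<^sub>N\<close>
  lifts to a walk of the same length in \<open>\<Gamma>\<close> with any prescribed start in the first orbit, so the
  sphere of radius \<open>i\<close> around an orbit consists of orbits of vertices at distance exactly \<open>i\<close> from a
  fixed vertex \<open>v\<close>, and \<open>G\<^sub>v\<close> permutes these transitively (\<open>lift_sphere\<close>, \<open>LDT_quotient\<close>).

  It remains to see that \<open>\<Gamma>\<close> covers \<open>\<Gamma>\<^sub>N\<close> (\<open>cover_or_complete_multipartite\<close>). An edge inside an orbit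
  would collapse \<open>\<Gamma>\<^sub>N\<close> to a point, so there is none. Suppose that \<open>v\<close> has two neighbours \<open>w\<close>, \<open>w'\<close> in
  one orbit \<open>B\<close>. They are at distance 2, and since \<open>G\<^sub>w\<close> is transitive on \<open>\<Gamma>\<^sub>2(w)\<close> and fixes \<open>B\<close>, the
  whole sphere \<open>\<Gamma>\<^sub>2(w)\<close> lies in \<open>B\<close>. By lifting, no orbit is at distance 2 from \<open>B\<close>, so \<open>B\<close> is adjacent
  to all other orbits. As \<open>\<Gamma>\<^sub>N\<close> is not a star centred at \<open>B\<close>, two of these are adjacent, and \<open>\<Gamma>\<close>
  contains a triangle. Two vertices with a common neighbour are \<open>G\<close>-equivalent, so the triangle makes
  \<open>G\<close> transitive on vertices. Hence \<open>\<Gamma>\<^sub>2(u)\<close> lies in the orbit of \<open>u\<close> for every \<open>u\<close>, all orbits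
  have the same size and are pairwise adjacent, and a vertex of a third orbit serves to show that
  vertices in different orbits are always adjacent: \<open>\<Gamma>\<close> is \<open>K\<^bsub>m[b]\<^esub>\<close> with \<open>m \<ge> 3\<close> and \<open>b \<ge> 2\<close>, which
  is excluded.
\<close>

section \<open>Walks and distance\<close>

text \<open>Cutting out closed subwalks only shortens a walk. So distances, defined by paths, can be
  measured by walks, which unlike paths survive a vertex map that is not injective and compose freely.\<close>

lemma (in wf_digraph) path_no_longer_than_walk:
  assumes "awalk u p v"
  shows "\<exists>q. apath u q v \<and> length q \<le> length p"
  using assms
proof (induction "length p" arbitrary: p rule: less_induct)
  case less
  show ?case
  proof (cases "distinct (awalk_verts u p)")
    case True
    with less.prems show ?thesis by (auto simp: apath_def)
  next
    case False
    obtain q r s where qrs: "awalk_cyc_decomp p = (q, r, s)" by (cases "awalk_cyc_decomp p")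
    from awalk_cyc_decomp_has_prop[OF less.prems False]
    have "p = q @ r @ s" "r \<noteq> []" "awalk u (q @ s) v"
      using less.prems by (auto simp: qrs closed_w_def dest: awalk_ends_eqD)
    with less.hyps[of "q @ s"] show ?thesis by force
  qed
qed

context pair_graph
begin

lemma awalk_imp_relpow: "awalk u p v \<Longrightarrow> (u, v) \<in> parcs G ^^ length p"
proof (induction p arbitrary: u)
  case Nil
  then show ?case by (simp add: awalk_Nil_iff)
next
  case (Cons e p)
  then show ?case
    by (cases e) (auto simp: awalk_Cons_iff intro!: relpow_Suc_I2 simp del: relpow.simps)
qed

lemma relpow_imp_awalk:
  "(u, v) \<in> parcs G ^^ n \<Longrightarrow> u \<in> pverts G \<Longrightarrow> \<exists>p. awalk u p v \<and> length p = n"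
proof (induction n arbitrary: u)
  case 0
  then show ?case by (auto simp: awalk_Nil_iff)
next
  case (Suc n)
  then obtain w where w: "(u, w) \<in> parcs G" "(w, v) \<in> parcs G ^^ n"
    by (metis relpow_Suc_D2)
  then obtain p where "awalk w p v" "length p = n"
    using Suc.IH[of w] in_arcsD2 by blast
  with w have "awalk u ((u, w) # p) v \<and> length ((u, w) # p) = Suc n"
    by (simp add: awalk_Cons_iff)
  then show ?case by blast
qed

text \<open>Walks of length \<open>n\<close> are pairs in the \<open>n\<close>-th power of the arc relation, which gives
  distance arguments a plain induction over \<open>n\<close>. Both sides are \<open>Least\<close> terms, so the equation
  covers unreachable \<open>v\<close> as well.\<close>

lemma gdist_relpow:
  assumes "u \<in> pverts G"
  shows "gdist G u v = (LEAST n. (u, v) \<in> parcs G ^^ n)"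
proof (cases "\<exists>n. (u, v) \<in> parcs G ^^ n")
  case False
  then have "(\<lambda>n. \<exists>p. apath u p v \<and> length p = n) = (\<lambda>n. (u, v) \<in> parcs G ^^ n)"
    using awalkI_apath awalk_imp_relpow by blast
  then show ?thesis by (simp only: gdist_def)
next
  case True
  let ?P = "\<lambda>n. \<exists>p. apath u p v \<and> length p = n"
  let ?n = "LEAST n. (u, v) \<in> parcs G ^^ n"
  have le: "?n \<le> n" if "?P n" for n
    using that by (metis Least_le awalkI_apath awalk_imp_relpow)
  have "(u, v) \<in> parcs G ^^ ?n" using True by (metis LeastI_ex)
  then obtain p where "apath u p v" "length p \<le> ?n"
    using relpow_imp_awalk[OF _ assms] path_no_longer_than_walk by metis
  with le have "?P ?n" by (metis le_antisym)
  with le show ?thesis unfolding gdist_def by (intro Least_equality) auto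
qed

lemma gdist_le: "u \<in> pverts G \<Longrightarrow> (u, v) \<in> parcs G ^^ n \<Longrightarrow> gdist G u v \<le> n"
  by (simp add: gdist_relpow Least_le)

lemma gdist_le_diam:
  assumes "u \<in> pverts G" "v \<in> pverts G"
  shows "gdist G u v \<le> diam G"
proof -
  have "{gdist G u v | u v. u \<in> pverts G \<and> v \<in> pverts G}
      = (\<lambda>(u, v). gdist G u v) ` (pverts G \<times> pverts G)" by auto
  then have "finite {gdist G u v | u v. u \<in> pverts G \<and> v \<in> pverts G}" by simp
  with assms show ?thesis unfolding diam_def by (blast intro: Max_ge)
qed

lemma connected_iff_walks:
  "Digraph_Component.connected (with_proj G) \<longleftrightarrow>
     pverts G \<noteq> {} \<and> (\<forall>u \<in> pverts G. \<forall>v \<in> pverts G. \<exists>n. (u, v) \<in> parcs G ^^ n)"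
proof -
  have "reachable (mk_symmetric (with_proj G)) u v \<longleftrightarrow> (\<exists>n. (u, v) \<in> parcs G ^^ n)"
    if "u \<in> pverts G" for u v
    using that reachable_mk_symmetric_eq[OF pair_sym_arcs, of u v]
    by (simp add: reachable_awalk) (metis awalk_imp_relpow relpow_imp_awalk)
  moreover have "pverts (mk_symmetric (with_proj G)) = pverts G"
    by (simp add: mk_symmetric_def)
  ultimately show ?thesis
    by (simp add: connected_def strongly_connected_def)
qed

lemma relpow_gdist:
  assumes "Digraph_Component.connected (with_proj G)" "u \<in> pverts G" "v \<in> pverts G"
  shows "(u, v) \<in> parcs G ^^ gdist G u v"
  using assms connected_iff_walks gdist_relpow[of u v] by (metis LeastI_ex)

lemma gsphere_1:
  assumes "Digraph_Component.connected (with_proj G)" and v: "v \<in> pverts G"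
  shows "gsphere G 1 v = {w. (v, w) \<in> parcs G}"
proof -
  have "(v, w) \<in> parcs G" if "w \<in> pverts G" "gdist G v w = 1" for w
    using relpow_gdist[OF assms, of w] that by simp
  moreover have "gdist G v w = 1" if w: "(v, w) \<in> parcs G" for w
  proof -
    have "gdist G v w \<le> 1" using gdist_le[OF v, of w 1] w by simp
    moreover have "gdist G v w \<noteq> 0"
      using relpow_gdist[OF assms in_arcsD2[OF w]] no_loops'[OF w] by (intro notI) simp
    ultimately show ?thesis by simp
  qed
  ultimately show ?thesis by (auto simp: gsphere_def dest: in_arcsD2)
qed

lemma gdist_eq_2:
  assumes "Digraph_Component.connected (with_proj G)"
    and uv: "(u, v) \<in> parcs G" and vw: "(v, w) \<in> parcs G"
    and "u \<noteq> w" "(u, w) \<notin> parcs G"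
  shows "gdist G u w = 2"
proof -
  note u = in_arcsD1[OF uv] and w = in_arcsD2[OF vw]
  have "(u, w) \<in> parcs G ^^ 2" using uv vw by (auto simp: numeral_2_eq_2)
  then have "gdist G u w \<le> 2" by (rule gdist_le[OF u])
  moreover have "gdist G u w \<noteq> 0" "gdist G u w \<noteq> 1"
    using relpow_gdist[OF assms(1) u w] assms(4,5) by (metis relpow_0_E, metis relpow_1)
  ultimately show ?thesis by simp
qed

end

section \<open>Images of a graph under a vertex map\<close>

text \<open>A normal quotient is determined by the map sending a vertex to its orbit.  Quotients of
  quotients become compositions of such maps, and a property of an image graph that is invariant
  under isomorphism depends only on the kernel of the map.\<close>

definition image_graph :: "('a \<Rightarrow> 'b) \<Rightarrow> 'a pair_pre_digraph \<Rightarrow> 'b pair_pre_digraph" where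
  "image_graph f \<Gamma> = \<lparr>pverts = f ` pverts \<Gamma>,
     parcs = {(f u, f v) | u v. (u, v) \<in> parcs \<Gamma> \<and> f u \<noteq> f v}\<rparr>"

lemma image_graph_simps [simp]:
  "pverts (image_graph f \<Gamma>) = f ` pverts \<Gamma>"
  "parcs (image_graph f \<Gamma>) = {(f u, f v) | u v. (u, v) \<in> parcs \<Gamma> \<and> f u \<noteq> f v}"
  by (simp_all add: image_graph_def)

lemma image_graph_cong:
  assumes "pair_graph \<Gamma>" "\<And>v. v \<in> pverts \<Gamma> \<Longrightarrow> f v = h v"
  shows "image_graph f \<Gamma> = image_graph h \<Gamma>"
proof -
  interpret pair_graph \<Gamma> by fact
  have "f u = h u \<and> f v = h v" if "(u, v) \<in> parcs \<Gamma>" for u v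
    using assms(2) in_arcsD1[OF that] in_arcsD2[OF that] by blast
  then have "{(f u, f v) | u v. (u, v) \<in> parcs \<Gamma> \<and> f u \<noteq> f v} =
      {(h u, h v) | u v. (u, v) \<in> parcs \<Gamma> \<and> h u \<noteq> h v}"
    by (metis (no_types, opaque_lifting))
  moreover have "f ` pverts \<Gamma> = h ` pverts \<Gamma>" using assms(2) by (rule image_cong[OF refl])
  ultimately show ?thesis by (simp add: image_graph_def)
qed

lemma image_graph_image_graph:
  "image_graph h (image_graph f \<Gamma>) = image_graph (\<lambda>v. h (f v)) \<Gamma>"
proof -
  have "{(h A, h B) | A B. (A, B) \<in> parcs (image_graph f \<Gamma>) \<and> h A \<noteq> h B} =
      {(h (f u), h (f v)) | u v. (u, v) \<in> parcs \<Gamma> \<and> h (f u) \<noteq> h (f v)}"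
    by (auto; metis)
  then show ?thesis by (simp add: image_graph_def image_image)
qed

lemma pair_graph_image_graph:
  assumes "pair_graph \<Gamma>"
  shows "pair_graph (image_graph f \<Gamma>)"
proof -
  interpret pair_graph \<Gamma> by fact
  have "parcs (image_graph f \<Gamma>) \<subseteq> f ` pverts \<Gamma> \<times> f ` pverts \<Gamma>"
    by (auto dest: in_arcsD1 in_arcsD2)
  moreover have "finite (f ` pverts \<Gamma> \<times> f ` pverts \<Gamma>)" using pair_finite_verts by blast
  ultimately have "finite (parcs (image_graph f \<Gamma>))" by (rule finite_subset)
  moreover have "symmetric (with_proj (image_graph f \<Gamma>))"
    unfolding symmetric_def
    by (rule symI) (auto; metis arcs_symmetric)
  ultimately show ?thesis
    by unfold_locales (auto intro: pair_finite_verts dest: in_arcsD1 in_arcsD2)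
qed

text \<open>Arcs inside a fibre of \<open>f\<close> disappear, which is why the image walk may be shorter.\<close>

lemma image_graph_walk:
  assumes "(u, v) \<in> parcs \<Gamma> ^^ n"
  shows "\<exists>m \<le> n. (f u, f v) \<in> parcs (image_graph f \<Gamma>) ^^ m"
  using assms
proof (induction n arbitrary: v)
  case 0
  then show ?case by (auto intro: exI[of _ 0])
next
  case (Suc n)
  then obtain w where "(u, w) \<in> parcs \<Gamma> ^^ n" and wv: "(w, v) \<in> parcs \<Gamma>" by auto
  with Suc.IH obtain m where m: "m \<le> n" "(f u, f w) \<in> parcs (image_graph f \<Gamma>) ^^ m" by blast
  show ?case
  proof (cases "f w = f v")
    case True
    with m show ?thesis by (metis le_SucI)
  next
    case False
    with wv have "(f w, f v) \<in> parcs (image_graph f \<Gamma>)" by auto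
    with m have "(f u, f v) \<in> parcs (image_graph f \<Gamma>) ^^ Suc m" by auto
    with m(1) show ?thesis by (metis Suc_le_mono)
  qed
qed

lemma connected_image_graph:
  assumes "pair_graph \<Gamma>" "Digraph_Component.connected (with_proj \<Gamma>)"
  shows "Digraph_Component.connected (with_proj (image_graph f \<Gamma>))"
proof -
  have "\<exists>n. (f u, f v) \<in> parcs (image_graph f \<Gamma>) ^^ n"
    if "u \<in> pverts \<Gamma>" "v \<in> pverts \<Gamma>" for u v
    using assms that image_graph_walk by (metis pair_graph.connected_iff_walks)
  moreover have "pverts \<Gamma> \<noteq> {}" using assms by (simp add: pair_graph.connected_iff_walks)
  ultimately show ?thesis
    using assms by (simp add: pair_graph.connected_iff_walks pair_graph_image_graph
        del: image_graph_simps(2))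
qed

section \<open>Degenerate graphs\<close>

text \<open>The graphs \<open>K\<^sub>1\<close>, \<open>K\<^sub>2\<close> and \<open>K\<^bsub>1,r\<^esub>\<close> with \<open>r \<ge> 2\<close> are exactly the stars with
  \<open>0\<close>, \<open>1\<close> and \<open>r\<close> leaves, so a single condition describes all of them.\<close>

lemma degenerate_iff_star:
  assumes "pair_graph \<Gamma>"
  shows "degenerate \<Gamma> \<longleftrightarrow> (\<exists>c \<in> pverts \<Gamma>.
    parcs \<Gamma> = {c} \<times> (pverts \<Gamma> - {c}) \<union> (pverts \<Gamma> - {c}) \<times> {c})"
    (is "_ \<longleftrightarrow> (\<exists>c \<in> _. ?star c)")
proof
  assume "degenerate \<Gamma>"
  then consider "complete_digraph 1 (with_proj \<Gamma>)" | "complete_digraph 2 (with_proj \<Gamma>)"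
    | r where "complete_bipartite_digraph 1 r (with_proj \<Gamma>)"
    by (auto simp: degenerate_def)
  then show "\<exists>c \<in> pverts \<Gamma>. ?star c"
  proof cases
    case 1
    then show ?thesis by (auto simp: complete_digraph_pair_def card_1_singleton_iff)
  next
    case 2
    then obtain a b where "pverts \<Gamma> = {a, b}" "a \<noteq> b"
        "parcs \<Gamma> = {(u, v). (u, v) \<in> pverts \<Gamma> \<times> pverts \<Gamma> \<and> u \<noteq> v}"
      by (auto simp: complete_digraph_pair_def card_2_iff)
    then show ?thesis by auto
  next
    case (3 r)
    then obtain U L where UL: "pverts \<Gamma> = U \<union> L" "U \<inter> L = {}" "card U = 1"
        "parcs \<Gamma> = U \<times> L \<union> L \<times> U"
      by (auto simp: complete_bipartite_digraph_pair_def)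
    then obtain c where "U = {c}" by (auto simp: card_1_singleton_iff)
    with UL have "c \<in> pverts \<Gamma>" "?star c" by auto
    then show ?thesis by blast
  qed
next
  assume "\<exists>c \<in> pverts \<Gamma>. ?star c"
  then obtain c where c: "c \<in> pverts \<Gamma>" and star: "?star c" by blast
  have fin: "finite (pverts \<Gamma>)"
    using assms by (simp add: pair_graph_def pair_digraph_def pair_fin_digraph.pair_finite_verts)
  then have card: "card (pverts \<Gamma>) = Suc (card (pverts \<Gamma> - {c}))"
    using c by (metis card_Suc_Diff1)
  consider "card (pverts \<Gamma> - {c}) = 0" | "card (pverts \<Gamma> - {c}) = 1" | "card (pverts \<Gamma> - {c}) \<ge> 2"
    by linarith
  then show "degenerate \<Gamma>"
  proof cases
    case 1
    then have "pverts \<Gamma> - {c} = {}" using fin by (metis card_0_eq finite_Diff)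
    with c have "pverts \<Gamma> = {c}" by auto
    with star have "complete_digraph 1 (with_proj \<Gamma>)" by (auto simp: complete_digraph_pair_def)
    then show ?thesis by (simp add: degenerate_def)
  next
    case 2
    then obtain d where d: "pverts \<Gamma> - {c} = {d}" by (auto simp: card_1_singleton_iff)
    then have "pverts \<Gamma> = {c, d}" "d \<noteq> c" using c by auto
    with star have "complete_digraph 2 (with_proj \<Gamma>)" by (auto simp: complete_digraph_pair_def)
    then show ?thesis by (simp add: degenerate_def)
  next
    case 3
    have "pverts \<Gamma> = {c} \<union> (pverts \<Gamma> - {c})" "{c} \<inter> (pverts \<Gamma> - {c}) = {}" using c by blast+
    with fin star
    have "complete_bipartite_digraph 1 (card (pverts \<Gamma> - {c})) (with_proj \<Gamma>)"
      unfolding complete_bipartite_digraph_pair_def by (metis card_1_singleton_iff One_nat_def)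
    with 3 show ?thesis by (auto simp: degenerate_def)
  qed
qed

text \<open>A map with the same kernel has an isomorphic image, so degeneracy carries over. The
  comparison of \<open>(\<Gamma>\<^sub>N)\<^bsub>M/N\<^esub>\<close> with \<open>\<Gamma>\<^sub>M\<close>, whose vertices have different types, takes this form.\<close>

lemma degenerate_image_graph_cong:
  assumes "pair_graph \<Gamma>"
    and ker: "\<And>u v. u \<in> pverts \<Gamma> \<Longrightarrow> v \<in> pverts \<Gamma> \<Longrightarrow> f u = f v \<longleftrightarrow> h u = h v"
    and "degenerate (image_graph f \<Gamma>)"
  shows "degenerate (image_graph h \<Gamma>)"
proof -
  interpret pair_graph \<Gamma> by fact
  obtain c where c: "c \<in> pverts \<Gamma>"
    and star: "parcs (image_graph f \<Gamma>) =
      {f c} \<times> (f ` pverts \<Gamma> - {f c}) \<union> (f ` pverts \<Gamma> - {f c}) \<times> {f c}"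
    using assms(3) by (auto simp: degenerate_iff_star[OF pair_graph_image_graph[OF assms(1)]]
        simp del: image_graph_simps(2))
  have edge: "h u = h c \<or> h v = h c" if uv: "(u, v) \<in> parcs \<Gamma>" "h u \<noteq> h v" for u v
  proof -
    note V = in_arcsD1[OF uv(1)] in_arcsD2[OF uv(1)]
    have "(f u, f v) \<in> parcs (image_graph f \<Gamma>)" using uv ker V by auto
    then have "f u = f c \<or> f v = f c" unfolding star by auto
    then show ?thesis using ker V c by blast
  qed
  have leaf: "\<exists>u v. (u, v) \<in> parcs \<Gamma> \<and> h u = h c \<and> h v = h x"
    if x: "x \<in> pverts \<Gamma>" "h x \<noteq> h c" for x
  proof -
    have "f x \<noteq> f c" using ker x c by blast
    with x have "(f c, f x) \<in> parcs (image_graph f \<Gamma>)" unfolding star by auto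
    then obtain u v where "(u, v) \<in> parcs \<Gamma>" "f u = f c" "f v = f x" by auto
    then show ?thesis using ker x c in_arcsD1 in_arcsD2 by metis
  qed
  have "parcs (image_graph h \<Gamma>) =
      {h c} \<times> (h ` pverts \<Gamma> - {h c}) \<union> (h ` pverts \<Gamma> - {h c}) \<times> {h c}" (is "?L = ?R")
  proof (intro equalityI subsetI)
    fix e assume "e \<in> ?L"
    then obtain u v where uv: "(u, v) \<in> parcs \<Gamma>" "h u \<noteq> h v" "e = (h u, h v)" by auto
    then have "h u = h c \<or> h v = h c" using edge by blast
    with uv in_arcsD1[OF uv(1)] in_arcsD2[OF uv(1)] show "e \<in> ?R" by auto
  next
    fix e assume "e \<in> ?R"
    then obtain x where x: "x \<in> pverts \<Gamma>" "h x \<noteq> h c" and e: "e = (h c, h x) \<or> e = (h x, h c)"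
      by auto
    obtain u v where uv: "(u, v) \<in> parcs \<Gamma>" "h u = h c" "h v = h x" using leaf[OF x] by blast
    have "(h u, h v) \<in> ?L"
      unfolding image_graph_simps using uv x(2) by (intro CollectI exI[of _ u] exI[of _ v]) auto
    moreover have "(h v, h u) \<in> ?L"
      unfolding image_graph_simps
      using uv x(2) arcs_symmetric[OF uv(1)] by (intro CollectI exI[of _ v] exI[of _ u]) auto
    ultimately show "e \<in> ?L" using e unfolding uv by blast
  qed
  with c show ?thesis
    by (auto simp: degenerate_iff_star[OF pair_graph_image_graph[OF assms(1)]]
        simp del: image_graph_simps(2))
qed

section \<open>Groups of permutations of the vertices\<close>

lemma perm_group_simps [simp]:
  "carrier (perm_group \<Gamma> G) = G"
  "\<one>\<^bsub>perm_group \<Gamma> G\<^esub> = (\<lambda>x \<in> pverts \<Gamma>. x)"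
  by (simp_all add: perm_group_def BijGroup_def)

lemma subgroup_Aut_BijGroup: "subgroup (carrier (Aut \<Gamma>)) (BijGroup (pverts \<Gamma>))"
proof -
  interpret B: group "BijGroup (pverts \<Gamma>)" by (rule group_BijGroup)
  have app: "f x \<in> pverts \<Gamma>" if "f \<in> Bij (pverts \<Gamma>)" "x \<in> pverts \<Gamma>" for f x
    using Bij_imp_funcset[OF that(1)] that(2) by auto
  have inv: "f (inv_into (pverts \<Gamma>) f x) = x"
    if "f \<in> Bij (pverts \<Gamma>)" "x \<in> pverts \<Gamma>" for f x
    using that by (auto simp: Bij_def bij_betw_def f_inv_into_f)
  show ?thesis
  proof (rule B.subgroupI)
    show "carrier (Aut \<Gamma>) \<subseteq> carrier (BijGroup (pverts \<Gamma>))"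
      by (auto simp: Aut_def BijGroup_def)
    have "(\<lambda>x \<in> pverts \<Gamma>. x) \<in> carrier (Aut \<Gamma>)" by (simp add: Aut_def id_Bij)
    then show "carrier (Aut \<Gamma>) \<noteq> {}" by blast
  next
    fix f assume f: "f \<in> carrier (Aut \<Gamma>)"
    then have fB: "f \<in> Bij (pverts \<Gamma>)" by (simp add: Aut_def)
    have "(inv_into (pverts \<Gamma>) f u, inv_into (pverts \<Gamma>) f v) \<in> parcs \<Gamma> \<longleftrightarrow> (u, v) \<in> parcs \<Gamma>"
      if "u \<in> pverts \<Gamma>" "v \<in> pverts \<Gamma>" for u v
    proof -
      have "(f (inv_into (pverts \<Gamma>) f u), f (inv_into (pverts \<Gamma>) f v)) \<in> parcs \<Gamma> \<longleftrightarrow>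
          (inv_into (pverts \<Gamma>) f u, inv_into (pverts \<Gamma>) f v) \<in> parcs \<Gamma>"
        using f that by (simp add: Aut_def Bij_inv_into_mem)
      then show ?thesis by (simp add: inv fB that)
    qed
    then show "inv\<^bsub>BijGroup (pverts \<Gamma>)\<^esub> f \<in> carrier (Aut \<Gamma>)"
      using restrict_inv_into_Bij[OF fB] by (simp add: inv_BijGroup[OF fB] Aut_def)
  next
    fix f h assume "f \<in> carrier (Aut \<Gamma>)" "h \<in> carrier (Aut \<Gamma>)"
    then show "f \<otimes>\<^bsub>BijGroup (pverts \<Gamma>)\<^esub> h \<in> carrier (Aut \<Gamma>)"
      by (simp add: Aut_def BijGroup_def compose_Bij compose_eq app)
  qed
qed

lemma subgroup_Aut_iff:
  "subgroup G (Aut \<Gamma>) \<longleftrightarrow>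
     subgroup G (BijGroup (pverts \<Gamma>)) \<and>
     (\<forall>g \<in> G. \<forall>u \<in> pverts \<Gamma>. \<forall>v \<in> pverts \<Gamma>. (g u, g v) \<in> parcs \<Gamma> \<longleftrightarrow> (u, v) \<in> parcs \<Gamma>)"
proof -
  have Aut: "Aut \<Gamma> = (BijGroup (pverts \<Gamma>))\<lparr>carrier := carrier (Aut \<Gamma>)\<rparr>" by (simp add: Aut_def)
  have "subgroup G (Aut \<Gamma>) \<longleftrightarrow> subgroup G (BijGroup (pverts \<Gamma>)) \<and> G \<subseteq> carrier (Aut \<Gamma>)"
    using group.incl_subgroup[OF group_BijGroup subgroup_Aut_BijGroup, of G \<Gamma>]
      group.subgroup_incl[OF group_BijGroup _ subgroup_Aut_BijGroup, of G \<Gamma>]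
      subgroup.subset[of G "Aut \<Gamma>"] Aut by metis
  moreover have "G \<subseteq> Bij (pverts \<Gamma>)" if "subgroup G (BijGroup (pverts \<Gamma>))"
    using subgroup.subset[OF that] by (simp add: BijGroup_def)
  ultimately show ?thesis by (auto simp: Aut_def)
qed

locale permutation_group =
  fixes \<Gamma> :: "'a pair_pre_digraph" and G :: "('a \<Rightarrow> 'a) set"
  assumes subgroup_BijGroup: "subgroup G (BijGroup (pverts \<Gamma>))"
begin

lemma perm_Bij: "g \<in> G \<Longrightarrow> g \<in> Bij (pverts \<Gamma>)"
  using subgroup.subset[OF subgroup_BijGroup] by (auto simp: BijGroup_def)

lemma group_perm_group: "group (perm_group \<Gamma> G)"
  unfolding perm_group_def
  using subgroup.subgroup_is_group[OF subgroup_BijGroup group_BijGroup] .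

lemma perm_closed: "g \<in> G \<Longrightarrow> x \<in> pverts \<Gamma> \<Longrightarrow> g x \<in> pverts \<Gamma>"
  using perm_Bij Bij_imp_funcset by blast

lemma mult_perm_group:
  "g \<in> G \<Longrightarrow> h \<in> G \<Longrightarrow> g \<otimes>\<^bsub>perm_group \<Gamma> G\<^esub> h = compose (pverts \<Gamma>) g h"
  using perm_Bij by (simp add: perm_group_def BijGroup_def)

lemma perm_id: "(\<lambda>x \<in> pverts \<Gamma>. x) \<in> G"
  using group.is_monoid[OF group_perm_group, THEN monoid.one_closed] by simp

lemma perm_compose: "g \<in> G \<Longrightarrow> h \<in> G \<Longrightarrow> compose (pverts \<Gamma>) g h \<in> G"
  using group.is_monoid[OF group_perm_group, THEN monoid.m_closed] by (simp add: mult_perm_group)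

lemma perm_mult_closed: "g \<in> G \<Longrightarrow> h \<in> G \<Longrightarrow> g \<otimes>\<^bsub>perm_group \<Gamma> G\<^esub> h \<in> G"
  by (simp add: mult_perm_group perm_compose)

lemma perm_inv_closed: "g \<in> G \<Longrightarrow> inv\<^bsub>perm_group \<Gamma> G\<^esub> g \<in> G"
  using group.inv_closed[OF group_perm_group] by simp

lemma perm_inv:
  assumes "g \<in> G" "x \<in> pverts \<Gamma>"
  shows "(inv\<^bsub>perm_group \<Gamma> G\<^esub> g) (g x) = x" "g ((inv\<^bsub>perm_group \<Gamma> G\<^esub> g) x) = x"
proof -
  interpret P: group "perm_group \<Gamma> G" by (rule group_perm_group)
  have "compose (pverts \<Gamma>) (inv\<^bsub>perm_group \<Gamma> G\<^esub> g) g = (\<lambda>x \<in> pverts \<Gamma>. x)"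
    using P.l_inv[of g] assms(1) by (simp add: mult_perm_group perm_inv_closed)
  then show "(inv\<^bsub>perm_group \<Gamma> G\<^esub> g) (g x) = x" using assms(2)
    by (metis compose_eq restrict_apply')
  have "compose (pverts \<Gamma>) g (inv\<^bsub>perm_group \<Gamma> G\<^esub> g) = (\<lambda>x \<in> pverts \<Gamma>. x)"
    using P.r_inv[of g] assms(1) by (simp add: mult_perm_group perm_inv_closed)
  then show "g ((inv\<^bsub>perm_group \<Gamma> G\<^esub> g) x) = x" using assms(2)
    by (metis compose_eq restrict_apply')
qed

lemma perm_inj: "g \<in> G \<Longrightarrow> inj_on g (pverts \<Gamma>)"
  by (metis inj_on_inverseI perm_inv(1))

lemma group_action_perm: "group_action (perm_group \<Gamma> G) (pverts \<Gamma>) (\<lambda>g. g)"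
proof -
  have "(\<lambda>g. g) \<in> hom (perm_group \<Gamma> G) (BijGroup (pverts \<Gamma>))"
    using perm_Bij by (auto simp: hom_def perm_group_def BijGroup_def)
  then show ?thesis
    using group_perm_group group_BijGroup
    by (simp add: group_action_def group_hom_def group_hom_axioms_def)
qed

abbreviation orb :: "'a \<Rightarrow> 'a set" where
  "orb \<equiv> orbit (perm_group \<Gamma> G) (\<lambda>g. g)"

lemma orb_eq_image: "orb v = (\<lambda>g. g v) ` G"
  by (auto simp: orbit_def)

lemma orb_self: "v \<in> pverts \<Gamma> \<Longrightarrow> v \<in> orb v"
  by (rule group_action.orbit_refl[OF group_action_perm])

lemma orb_subset: "v \<in> pverts \<Gamma> \<Longrightarrow> orb v \<subseteq> pverts \<Gamma>"
  by (auto simp: orb_eq_image perm_closed)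

lemma orb_eq_iff:
  assumes "u \<in> pverts \<Gamma>" "v \<in> pverts \<Gamma>"
  shows "orb u = orb v \<longleftrightarrow> v \<in> orb u"
proof
  interpret A: group_action "perm_group \<Gamma> G" "pverts \<Gamma>" "\<lambda>g. g" by (rule group_action_perm)
  assume v: "v \<in> orb u"
  show "orb u = orb v"
  proof
    show "orb u \<subseteq> orb v"
      using A.orbit_trans[OF assms(2,1)] A.orbit_sym[OF assms v] orb_subset[OF assms(1)] by blast
    show "orb v \<subseteq> orb u"
      using A.orbit_trans[OF assms _ v] orb_subset[OF assms(2)] by blast
  qed
qed (use orb_self assms in blast)

lemma orb_perm: "g \<in> G \<Longrightarrow> v \<in> pverts \<Gamma> \<Longrightarrow> orb (g v) = orb v"
  by (metis image_eqI orb_eq_iff orb_eq_image perm_closed)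

lemma orbE:
  assumes "u \<in> pverts \<Gamma>" "v \<in> pverts \<Gamma>" "orb u = orb v"
  obtains g where "g \<in> G" "g u = v"
  using assms(3) that unfolding orb_eq_iff[OF assms(1,2)] by (auto simp: orb_eq_image)

lemma quotient_graph_eq_image_graph:
  assumes "pair_graph \<Gamma>"
  shows "quotient_graph \<Gamma> G = image_graph orb \<Gamma>"
proof -
  interpret pair_graph \<Gamma> by fact
  have "{(B1, B2). B1 \<in> orb ` pverts \<Gamma> \<and> B2 \<in> orb ` pverts \<Gamma> \<and> B1 \<noteq> B2 \<and>
            (\<exists>v \<in> B1. \<exists>w \<in> B2. (v, w) \<in> parcs \<Gamma>)} = parcs (image_graph orb \<Gamma>)" (is "?L = ?R")
  proof (intro equalityI subsetI; clarsimp simp del: image_graph_simps(2))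
    fix u v u' v'
    assume "u \<in> pverts \<Gamma>" "v \<in> pverts \<Gamma>" "orb u \<noteq> orb v" "u' \<in> orb u" "v' \<in> orb v"
      and "(u', v') \<in> parcs \<Gamma>"
    moreover from this have "orb u' = orb u" "orb v' = orb v"
      using orb_eq_iff in_arcsD1 in_arcsD2 by blast+
    ultimately show "(orb u, orb v) \<in> ?R"
      unfolding image_graph_simps by (intro CollectI exI[of _ u'] exI[of _ v']) auto
  next
    fix A B assume "(A, B) \<in> parcs (image_graph orb \<Gamma>)"
    then obtain u v where "(u, v) \<in> parcs \<Gamma>" "orb u \<noteq> orb v" "A = orb u" "B = orb v" by auto
    with in_arcsD1 in_arcsD2 orb_self
    show "A \<in> orb ` pverts \<Gamma> \<and> B \<in> orb ` pverts \<Gamma> \<and> A \<noteq> B \<and>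
            (\<exists>v \<in> A. \<exists>w \<in> B. (v, w) \<in> parcs \<Gamma>)" by blast
  qed
  moreover have "orbits (perm_group \<Gamma> G) (pverts \<Gamma>) (\<lambda>g. g) = orb ` pverts \<Gamma>"
    by (auto simp: orbits_def)
  ultimately show ?thesis by (simp add: quotient_graph_def image_graph_def Let_def)
qed

lemma finite_perms: "finite (pverts \<Gamma>) \<Longrightarrow> finite G"
  by (rule finite_subset[OF _ finite_PiE[of "pverts \<Gamma>" "\<lambda>_. pverts \<Gamma>"]])
     (auto dest!: perm_Bij simp: PiE_def dest: Bij_imp_extensional Bij_imp_funcset[THEN funcset_mem])

end

section \<open>Normal subgroups and the action on their orbits\<close>

text \<open>The permutation of the set of \<open>N\<close>-orbits induced by a single vertex permutation; on a coset
  of \<open>N\<close> it is constant, with value the action of that coset.\<close>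

definition orbit_perm :: "'a pair_pre_digraph \<Rightarrow> ('a \<Rightarrow> 'a) set \<Rightarrow> ('a \<Rightarrow> 'a) \<Rightarrow> 'a set \<Rightarrow> 'a set" where
  "orbit_perm \<Gamma> N g = (\<lambda>B \<in> pverts (quotient_graph \<Gamma> N). g ` B)"

locale normal_perms = permutation_group +
  fixes N :: "('a \<Rightarrow> 'a) set"
  assumes graph: "pair_graph \<Gamma>" and normal: "N \<lhd> perm_group \<Gamma> G"
begin

sublocale nrm: normal N "perm_group \<Gamma> G" by (rule normal)

lemma N_subset: "N \<subseteq> G"
  using nrm.subset by simp

sublocale N: permutation_group \<Gamma> N
  using group.incl_subgroup[OF group_BijGroup subgroup_BijGroup] nrm.subgroup_axioms
  by (simp add: permutation_group_def perm_group_def)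

lemma quotient_simps:
  "pverts (quotient_graph \<Gamma> N) = N.orb ` pverts \<Gamma>"
  "parcs (quotient_graph \<Gamma> N) = {(N.orb u, N.orb v) | u v. (u, v) \<in> parcs \<Gamma> \<and> N.orb u \<noteq> N.orb v}"
  by (simp_all add: N.quotient_graph_eq_image_graph[OF graph])

lemma conj_closed:
  assumes "g \<in> G" "n \<in> N"
  obtains n' where "n' \<in> N" "\<And>x. x \<in> pverts \<Gamma> \<Longrightarrow> g (n x) = n' (g x)"
proof -
  let ?i = "inv\<^bsub>perm_group \<Gamma> G\<^esub> g"
  let ?n' = "g \<otimes>\<^bsub>perm_group \<Gamma> G\<^esub> n \<otimes>\<^bsub>perm_group \<Gamma> G\<^esub> ?i"
  have n: "n \<in> G" using assms(2) N_subset by blast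
  have i: "?i \<in> G" by (rule perm_inv_closed[OF assms(1)])
  have "?n' \<in> N" using nrm.inv_op_closed2[of g n] assms by simp
  moreover have "g (n x) = ?n' (g x)" if "x \<in> pverts \<Gamma>" for x
    using that assms(1) n i
    by (simp add: mult_perm_group perm_compose compose_eq perm_closed perm_inv)
  ultimately show thesis by (rule that)
qed

text \<open>Normality, in the form \<open>g N = N g\<close>, is what makes \<open>G\<close> permute the \<open>N\<close>-orbits.\<close>

lemma image_orb:
  assumes "g \<in> G" "v \<in> pverts \<Gamma>"
  shows "g ` N.orb v = N.orb (g v)"
proof
  show "g ` N.orb v \<subseteq> N.orb (g v)"
  proof (clarsimp simp: N.orb_eq_image)
    fix n assume "n \<in> N"
    with conj_closed[OF assms(1)] assms(2) show "g (n v) \<in> (\<lambda>n. n (g v)) ` N" by (metis image_eqI)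
  qed
  let ?i = "inv\<^bsub>perm_group \<Gamma> G\<^esub> g"
  show "N.orb (g v) \<subseteq> g ` N.orb v"
  proof (clarsimp simp: N.orb_eq_image)
    fix n assume n: "n \<in> N"
    have gv: "g v \<in> pverts \<Gamma>" by (rule perm_closed[OF assms])
    obtain n' where "n' \<in> N" "?i (n (g v)) = n' (?i (g v))"
      using conj_closed[OF perm_inv_closed[OF assms(1)] n] gv by metis
    then have "n' \<in> N" "n (g v) = g (n' v)"
      using perm_inv[OF assms(1)] assms(2) N.perm_closed[OF n gv] by metis+
    then show "n (g v) \<in> g ` (\<lambda>n. n v) ` N" by blast
  qed
qed

lemma orb_eq_perm:
  assumes "g \<in> G" "u \<in> pverts \<Gamma>" "v \<in> pverts \<Gamma>"
  shows "N.orb (g u) = N.orb (g v) \<longleftrightarrow> N.orb u = N.orb v"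
proof
  assume "N.orb (g u) = N.orb (g v)"
  then have "g ` N.orb u = g ` N.orb v" by (simp add: image_orb assms)
  then show "N.orb u = N.orb v"
    using inj_on_image_eq_iff[OF perm_inj[OF assms(1)]] N.orb_subset assms by blast
qed (use assms image_orb in metis)

lemma orbit_perm_orb:
  "g \<in> G \<Longrightarrow> v \<in> pverts \<Gamma> \<Longrightarrow> orbit_perm \<Gamma> N g (N.orb v) = N.orb (g v)"
  by (simp add: orbit_perm_def quotient_simps image_orb)

lemma orbit_perm_Bij:
  assumes g: "g \<in> G"
  shows "orbit_perm \<Gamma> N g \<in> Bij (pverts (quotient_graph \<Gamma> N))"
proof -
  have "inj_on (orbit_perm \<Gamma> N g) (N.orb ` pverts \<Gamma>)"
    using g by (auto simp: inj_on_def orbit_perm_orb orb_eq_perm)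
  moreover have "orbit_perm \<Gamma> N g ` N.orb ` pverts \<Gamma> = N.orb ` pverts \<Gamma>"
  proof
    show "orbit_perm \<Gamma> N g ` N.orb ` pverts \<Gamma> \<subseteq> N.orb ` pverts \<Gamma>"
      using g by (auto simp: orbit_perm_orb perm_closed)
    show "N.orb ` pverts \<Gamma> \<subseteq> orbit_perm \<Gamma> N g ` N.orb ` pverts \<Gamma>"
    proof clarify
      fix v assume v: "v \<in> pverts \<Gamma>"
      let ?u = "(inv\<^bsub>perm_group \<Gamma> G\<^esub> g) v"
      have "?u \<in> pverts \<Gamma>" using perm_closed[OF perm_inv_closed[OF g] v] .
      then have "orbit_perm \<Gamma> N g (N.orb ?u) = N.orb v"
        by (simp add: orbit_perm_orb g perm_inv v)
      with \<open>?u \<in> pverts \<Gamma>\<close> show "N.orb v \<in> orbit_perm \<Gamma> N g ` N.orb ` pverts \<Gamma>"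
        by (metis imageI)
    qed
  qed
  ultimately show ?thesis
    by (simp add: Bij_def bij_betw_def quotient_simps) (simp add: orbit_perm_def quotient_simps)
qed

sublocale orbit_hom: group_hom "perm_group \<Gamma> G" "BijGroup (pverts (quotient_graph \<Gamma> N))"
  "orbit_perm \<Gamma> N"
proof -
  have "orbit_perm \<Gamma> N (compose (pverts \<Gamma>) g h) =
      compose (pverts (quotient_graph \<Gamma> N)) (orbit_perm \<Gamma> N g) (orbit_perm \<Gamma> N h)"
    if gh: "g \<in> G" "h \<in> G" for g h
  proof (rule extensionalityI[of _ "pverts (quotient_graph \<Gamma> N)"])
    fix B assume "B \<in> pverts (quotient_graph \<Gamma> N)"
    then obtain v where "v \<in> pverts \<Gamma>" "B = N.orb v" by (auto simp: quotient_simps)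
    then show "orbit_perm \<Gamma> N (compose (pverts \<Gamma>) g h) B =
        compose (pverts (quotient_graph \<Gamma> N)) (orbit_perm \<Gamma> N g) (orbit_perm \<Gamma> N h) B"
      using gh by (simp add: orbit_perm_orb perm_compose compose_eq quotient_simps perm_closed)
  qed (auto simp: orbit_perm_def)
  then have "orbit_perm \<Gamma> N \<in> hom (perm_group \<Gamma> G) (BijGroup (pverts (quotient_graph \<Gamma> N)))"
    by (auto simp: hom_def mult_perm_group) (auto simp: BijGroup_def orbit_perm_Bij)
  then show "group_hom (perm_group \<Gamma> G) (BijGroup (pverts (quotient_graph \<Gamma> N))) (orbit_perm \<Gamma> N)"
    using group_perm_group group_BijGroup by (simp add: group_hom_def group_hom_axioms_def)
qed

lemma quotient_action_coset:
  assumes g: "g \<in> G"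
  shows "quotient_action \<Gamma> N (N #>\<^bsub>perm_group \<Gamma> G\<^esub> g) = orbit_perm \<Gamma> N g"
proof -
  have "(\<Union>h \<in> N #>\<^bsub>perm_group \<Gamma> G\<^esub> g. h ` N.orb v) = g ` N.orb v" if v: "v \<in> pverts \<Gamma>" for v
  proof -
    have *: "(n \<otimes>\<^bsub>perm_group \<Gamma> G\<^esub> g) ` N.orb v = g ` N.orb v" if n: "n \<in> N" for n
    proof -
      have "n \<in> G" using n N_subset by blast
      then show ?thesis
        using g v n image_orb[of "compose (pverts \<Gamma>) n g" v] N.orb_perm[of n "g v"]
        by (simp add: mult_perm_group perm_compose image_orb compose_eq perm_closed)
    qed
    moreover have "N \<noteq> {}" using N.perm_id by blast
    ultimately show ?thesis by (simp add: r_coset_def)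
  qed
  then show ?thesis
    unfolding quotient_action_def orbit_perm_def quotient_simps
    by (intro restrict_ext) (elim imageE, simp)
qed

lemma quotient_perms_eq: "quotient_perms \<Gamma> G N = orbit_perm \<Gamma> N ` G"
  by (auto simp: quotient_perms_def carrier_FactGroup quotient_action_coset image_image)

end

section \<open>The correspondence of normal subgroups\<close>

context normal_perms
begin

lemma orbit_perm_N:
  assumes "n \<in> N"
  shows "orbit_perm \<Gamma> N n = \<one>\<^bsub>BijGroup (pverts (quotient_graph \<Gamma> N))\<^esub>"
proof (rule extensionalityI[of _ "pverts (quotient_graph \<Gamma> N)"])
  fix B assume "B \<in> pverts (quotient_graph \<Gamma> N)"
  then obtain v where "v \<in> pverts \<Gamma>" "B = N.orb v" by (auto simp: quotient_simps)
  with assms N_subset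
  show "orbit_perm \<Gamma> N n B = \<one>\<^bsub>BijGroup (pverts (quotient_graph \<Gamma> N))\<^esub> B"
    by (simp add: BijGroup_def quotient_simps orbit_perm_orb[OF subsetD[OF N_subset]] N.orb_perm)
qed (auto simp: BijGroup_def orbit_perm_def)

lemma pair_graph_quotient: "pair_graph (quotient_graph \<Gamma> N)"
  by (simp add: N.quotient_graph_eq_image_graph graph pair_graph_image_graph)

lemma subgroup_orbit_perms:
  "subgroup (orbit_perm \<Gamma> N ` G) (BijGroup (pverts (quotient_graph \<Gamma> N)))"
  using orbit_hom.img_is_subgroup by simp

text \<open>The correspondence between normal subgroups of \<open>G/N\<close> and normal subgroups of \<open>G\<close> above
  \<open>N\<close>, together with \<open>(\<Gamma>\<^sub>N)\<^bsub>M/N\<^esub> \<cong> \<Gamma>\<^sub>M\<close>. The isomorphism appears only as far as it transports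
  degeneracy: sending a vertex to its \<open>M\<close>-orbit, or to the orbit of its \<open>N\<close>-orbit, are maps with the
  same kernel.\<close>

lemma preimage_normal:
  assumes N': "N' \<lhd> perm_group (quotient_graph \<Gamma> N) (orbit_perm \<Gamma> N ` G)"
  defines "M \<equiv> {g \<in> G. orbit_perm \<Gamma> N g \<in> N'}"
  shows "M \<lhd> perm_group \<Gamma> G" "N \<subseteq> M"
    "degenerate (quotient_graph \<Gamma> M) \<Longrightarrow> degenerate (quotient_graph (quotient_graph \<Gamma> N) N')"
proof -
  let ?Q = "quotient_graph \<Gamma> N" and ?\<theta> = "orbit_perm \<Gamma> N"
  interpret Q: normal_perms ?Q "?\<theta> ` G" N'
    using N' pair_graph_quotient subgroup_orbit_perms
    by (simp add: normal_perms_def normal_perms_axioms_def permutation_group_def)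
  interpret h: group_hom "perm_group \<Gamma> G" "perm_group ?Q (?\<theta> ` G)" ?\<theta>
  proof -
    have "?\<theta> \<in> hom (perm_group \<Gamma> G) (perm_group ?Q (?\<theta> ` G))"
      using orbit_hom.hom_mult by (auto simp: hom_def) (simp add: perm_group_def)
    then show "group_hom (perm_group \<Gamma> G) (perm_group ?Q (?\<theta> ` G)) ?\<theta>"
      using group_perm_group Q.group_perm_group by (simp add: group_hom_def group_hom_axioms_def)
  qed
  show NM: "N \<subseteq> M"
    using N_subset orbit_perm_N Q.N.perm_id by (auto simp: M_def BijGroup_def)
  have inv: "inv\<^bsub>perm_group ?Q (?\<theta> ` G)\<^esub> n \<in> N'" if "n \<in> N'" for n
    using Q.nrm.m_inv_closed[OF that] .
  have "subgroup M (perm_group \<Gamma> G)"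
  proof (rule group.subgroupI[OF group_perm_group])
    show "M \<subseteq> carrier (perm_group \<Gamma> G)" by (auto simp: M_def)
    show "M \<noteq> {}" using N.perm_id NM by blast
  next
    fix a assume a: "a \<in> M"
    then have "?\<theta> (inv\<^bsub>perm_group \<Gamma> G\<^esub> a) \<in> N'"
      using h.hom_inv[of a] inv by (simp add: M_def)
    with a show "inv\<^bsub>perm_group \<Gamma> G\<^esub> a \<in> M" by (simp add: M_def perm_inv_closed)
  next
    fix a b assume ab: "a \<in> M" "b \<in> M"
    then have "?\<theta> (a \<otimes>\<^bsub>perm_group \<Gamma> G\<^esub> b) \<in> N'"
      using h.hom_mult[of a b] Q.nrm.m_closed by (simp add: M_def)
    with ab perm_mult_closed[of a b] show "a \<otimes>\<^bsub>perm_group \<Gamma> G\<^esub> b \<in> M" by (simp add: M_def)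
  qed
  moreover have "g \<otimes>\<^bsub>perm_group \<Gamma> G\<^esub> a \<otimes>\<^bsub>perm_group \<Gamma> G\<^esub> inv\<^bsub>perm_group \<Gamma> G\<^esub> g \<in> M"
    if g: "g \<in> G" and a: "a \<in> M" for g a
  proof -
    have aG: "a \<in> G" using a by (simp add: M_def)
    have "?\<theta> (g \<otimes>\<^bsub>perm_group \<Gamma> G\<^esub> a \<otimes>\<^bsub>perm_group \<Gamma> G\<^esub> inv\<^bsub>perm_group \<Gamma> G\<^esub> g) \<in> N'"
      using Q.nrm.inv_op_closed2[of "?\<theta> g" "?\<theta> a"] g aG a perm_mult_closed[of g a] perm_inv_closed[OF g]
      by (simp add: h.hom_mult h.hom_inv M_def del: orbit_hom.hom_mult orbit_hom.hom_inv)
    then show ?thesis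
      using perm_mult_closed[OF perm_mult_closed[of g a]] g aG perm_inv_closed[OF g] by (simp add: M_def)
  qed
  ultimately show M: "M \<lhd> perm_group \<Gamma> G" by (simp add: group.normal_inv_iff[OF group_perm_group])
  interpret M: normal_perms \<Gamma> G M
    using M graph subgroup_BijGroup
    by (simp add: normal_perms_def normal_perms_axioms_def permutation_group_def)
  have ker: "M.N.orb u = M.N.orb v \<longleftrightarrow> Q.N.orb (N.orb u) = Q.N.orb (N.orb v)"
    if u: "u \<in> pverts \<Gamma>" and v: "v \<in> pverts \<Gamma>" for u v
  proof
    assume "M.N.orb u = M.N.orb v"
    then obtain g where g: "g \<in> M" "g u = v" using M.N.orbE u v by metis
    then have "?\<theta> g (N.orb u) = N.orb v" using u by (simp add: M_def orbit_perm_orb)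
    moreover have "?\<theta> g \<in> N'" using g by (simp add: M_def)
    ultimately show "Q.N.orb (N.orb u) = Q.N.orb (N.orb v)"
      using Q.N.orb_perm[of "?\<theta> g" "N.orb u"] u by (simp add: quotient_simps)
  next
    assume "Q.N.orb (N.orb u) = Q.N.orb (N.orb v)"
    then obtain n' where n': "n' \<in> N'" "n' (N.orb u) = N.orb v"
      using Q.N.orbE[of "N.orb u" "N.orb v"] u v by (auto simp: quotient_simps)
    then obtain g where g: "g \<in> G" "n' = ?\<theta> g" using Q.N_subset by blast
    then have "N.orb (g u) = N.orb v" using n' u by (simp add: orbit_perm_orb)
    then obtain n where "n \<in> N" "n (g u) = v"
      using N.orbE[OF perm_closed[OF g(1) u] v] by blast
    moreover have "g \<in> M" using g n' by (simp add: M_def)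
    ultimately show "M.N.orb u = M.N.orb v"
      using NM M.N.orb_perm[of g u] M.N.orb_perm[of n "g u"] u perm_closed[OF g(1) u] by auto
  qed
  assume "degenerate (quotient_graph \<Gamma> M)"
  then have "degenerate (image_graph (\<lambda>v. Q.N.orb (N.orb v)) \<Gamma>)"
    unfolding M.N.quotient_graph_eq_image_graph[OF graph]
    by (rule degenerate_image_graph_cong[OF graph, rotated]) (rule ker)
  moreover have "image_graph f ?Q = image_graph (\<lambda>v. f (N.orb v)) \<Gamma>" for f :: "'a set \<Rightarrow> 'a set set"
    by (simp add: N.quotient_graph_eq_image_graph[OF graph] image_graph_image_graph)
  ultimately show "degenerate (quotient_graph ?Q N')"
    unfolding Q.N.quotient_graph_eq_image_graph[OF pair_graph_quotient] by metis
qed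

text \<open>An element of the kernel moves each vertex within its \<open>N\<close>-orbit, so enlarging \<open>N\<close> to the
  kernel changes no orbit.\<close>

lemma quotient_graph_kernel:
  defines "K \<equiv> kernel (perm_group \<Gamma> G) (BijGroup (pverts (quotient_graph \<Gamma> N))) (orbit_perm \<Gamma> N)"
  shows "K \<lhd> perm_group \<Gamma> G" "N \<subseteq> K" "quotient_graph \<Gamma> K = quotient_graph \<Gamma> N"
proof -
  show K: "K \<lhd> perm_group \<Gamma> G" unfolding K_def by (rule orbit_hom.normal_kernel)
  show NK: "N \<subseteq> K" using orbit_perm_N N_subset by (auto simp: K_def kernel_def)
  interpret K: normal_perms \<Gamma> G K
    using K graph subgroup_BijGroup
    by (simp add: normal_perms_def normal_perms_axioms_def permutation_group_def)
  have "K.N.orb v = N.orb v" if v: "v \<in> pverts \<Gamma>" for v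
  proof
    show "N.orb v \<subseteq> K.N.orb v" using NK by (auto simp: N.orb_eq_image K.N.orb_eq_image)
    show "K.N.orb v \<subseteq> N.orb v"
    proof (clarsimp simp: K.N.orb_eq_image)
      fix k assume k: "k \<in> K"
      then have kG: "k \<in> G" and "orbit_perm \<Gamma> N k = \<one>\<^bsub>BijGroup (pverts (quotient_graph \<Gamma> N))\<^esub>"
        by (auto simp: K_def kernel_def)
      then have "orbit_perm \<Gamma> N k (N.orb v) = N.orb v"
        using v by (simp add: BijGroup_def quotient_simps)
      then have "N.orb (k v) = N.orb v" using orbit_perm_orb[OF kG v] by simp
      then show "k v \<in> N.orb v" using N.orb_self[OF perm_closed[OF kG v]] by simp
    qed
  qed
  then show "quotient_graph \<Gamma> K = quotient_graph \<Gamma> N"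
    unfolding K.N.quotient_graph_eq_image_graph[OF graph] N.quotient_graph_eq_image_graph[OF graph]
    by (intro image_graph_cong[OF graph]) simp
qed

lemma faithful_quotient_action:
  assumes "kernel (perm_group \<Gamma> G) (BijGroup (pverts (quotient_graph \<Gamma> N))) (orbit_perm \<Gamma> N) = N"
  shows "faithful_action (perm_group \<Gamma> G Mod N) (pverts (quotient_graph \<Gamma> N))
    (quotient_action \<Gamma> N)"
proof -
  let ?P = "perm_group \<Gamma> G" and ?B = "BijGroup (pverts (quotient_graph \<Gamma> N))"
  have "quotient_action \<Gamma> N \<in> hom (?P Mod N) ?B"
  proof (rule homI)
    fix C assume "C \<in> carrier (?P Mod N)"
    then obtain g where "g \<in> G" "C = N #>\<^bsub>?P\<^esub> g" by (auto simp: carrier_FactGroup)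
    then show "quotient_action \<Gamma> N C \<in> carrier ?B"
      using orbit_hom.hom_closed by (simp add: quotient_action_coset)
  next
    fix C D assume "C \<in> carrier (?P Mod N)" "D \<in> carrier (?P Mod N)"
    then obtain g h where g: "g \<in> G" "C = N #>\<^bsub>?P\<^esub> g" and h: "h \<in> G" "D = N #>\<^bsub>?P\<^esub> h"
      by (auto simp: carrier_FactGroup)
    then have "C \<otimes>\<^bsub>?P Mod N\<^esub> D = N #>\<^bsub>?P\<^esub> (g \<otimes>\<^bsub>?P\<^esub> h)" by (simp add: nrm.rcos_sum)
    then show "quotient_action \<Gamma> N (C \<otimes>\<^bsub>?P Mod N\<^esub> D) =
        quotient_action \<Gamma> N C \<otimes>\<^bsub>?B\<^esub> quotient_action \<Gamma> N D"
      using g h perm_mult_closed[of g h] orbit_hom.hom_mult[of g h] by (simp add: quotient_action_coset)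
  qed
  moreover have "inj_on (quotient_action \<Gamma> N) (carrier (?P Mod N))"
  proof (rule inj_onI)
    fix C D assume "C \<in> carrier (?P Mod N)" "D \<in> carrier (?P Mod N)"
      and eq: "quotient_action \<Gamma> N C = quotient_action \<Gamma> N D"
    then obtain g h where g: "g \<in> G" "C = N #>\<^bsub>?P\<^esub> g" and h: "h \<in> G" "D = N #>\<^bsub>?P\<^esub> h"
      by (auto simp: carrier_FactGroup)
    with eq have "orbit_perm \<Gamma> N g = orbit_perm \<Gamma> N h" by (simp add: quotient_action_coset)
    then show "C = D"
      using orbit_hom.FactGroup_subset[of g h] orbit_hom.FactGroup_subset[of h g] g h
      unfolding assms by auto
  qed
  ultimately show ?thesis
    using nrm.factorgroup_is_group group_BijGroup
    by (simp add: faithful_action_def faithful_action_axioms_def group_action_def group_hom_def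
        group_hom_axioms_def)
qed

end

section \<open>Normal quotients of locally distance transitive graphs\<close>

locale ldt_normal = normal_perms +
  fixes s :: nat
  assumes LDT: "LDT_relative s \<Gamma> G"
begin

sublocale gr: pair_graph \<Gamma> by (rule graph)

lemma conn: "Digraph_Component.connected (with_proj \<Gamma>)"
  using LDT by (simp add: LDT_relative_def)

lemma connecting_walk:
  assumes "u \<in> pverts \<Gamma>" "v \<in> pverts \<Gamma>"
  obtains n where "(u, v) \<in> parcs \<Gamma> ^^ n"
  using conn assms gr.connected_iff_walks by blast

lemma arc_perm:
  "g \<in> G \<Longrightarrow> u \<in> pverts \<Gamma> \<Longrightarrow> v \<in> pverts \<Gamma> \<Longrightarrow> (g u, g v) \<in> parcs \<Gamma> \<longleftrightarrow> (u, v) \<in> parcs \<Gamma>"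
  using LDT by (simp add: LDT_relative_def locally_distance_transitive_def subgroup_Aut_iff)

text \<open>A nonempty sphere of radius \<open>i\<close> forces \<open>i \<le> diam \<Gamma>\<close>, so \<open>s\<close> alone bounds the radii.\<close>

lemma stabilizer_transitive:
  assumes "v \<in> pverts \<Gamma>" "1 \<le> i" "i \<le> s" "x \<in> gsphere \<Gamma> i v" "y \<in> gsphere \<Gamma> i v"
  obtains g where "g \<in> G" "g v = v" "g x = y"
proof -
  have "x \<in> pverts \<Gamma>" "gdist \<Gamma> v x = i" using assms(4) by (auto simp: gsphere_def)
  then have "i \<le> diam \<Gamma>" using gr.gdist_le_diam[OF assms(1)] by blast
  then have "i \<in> {1..min s (diam \<Gamma>)}" using assms by simp
  moreover have "\<forall>v \<in> pverts \<Gamma>. \<forall>i \<in> {1..min s (diam \<Gamma>)}. \<forall>x \<in> gsphere \<Gamma> i v. \<forall>y \<in> gsphere \<Gamma> i v.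
        \<exists>g \<in> stabilizer (perm_group \<Gamma> G) (\<lambda>g. g) v. g x = y"
    using LDT unfolding LDT_relative_def locally_distance_transitive_def by blast
  ultimately have "\<exists>g \<in> stabilizer (perm_group \<Gamma> G) (\<lambda>g. g) v. g x = y"
    using assms by blast
  then show thesis by (auto simp: stabilizer_def intro: that)
qed

text \<open>An edge between two orbits can be translated by \<open>N\<close> so that it starts at any given vertex of
  the first orbit.\<close>

lemma orb_neighbour:
  assumes "u \<in> pverts \<Gamma>" "N.orb u = N.orb u'" "(u', w') \<in> parcs \<Gamma>"
  obtains w where "(u, w) \<in> parcs \<Gamma>" "N.orb w = N.orb w'"
proof -
  note u' = gr.in_arcsD1[OF assms(3)] and w' = gr.in_arcsD2[OF assms(3)]
  obtain n where n: "n \<in> N" "n u' = u" using N.orbE[OF u' assms(1)] assms(2) by metis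
  then have "(u, n w') \<in> parcs \<Gamma>" using arc_perm[of n u' w'] u' w' assms(3) N_subset by auto
  then show thesis using that N.orb_perm[OF n(1) w'] by blast
qed

lemma lift_walk:
  assumes "(N.orb v, B) \<in> parcs (quotient_graph \<Gamma> N) ^^ n" "v \<in> pverts \<Gamma>"
  shows "\<exists>w \<in> pverts \<Gamma>. (v, w) \<in> parcs \<Gamma> ^^ n \<and> N.orb w = B"
  using assms(1)
proof (induction n arbitrary: B)
  case 0
  then show ?case using assms(2) by auto
next
  case (Suc n)
  then obtain C where C: "(N.orb v, C) \<in> parcs (quotient_graph \<Gamma> N) ^^ n"
    and CB: "(C, B) \<in> parcs (quotient_graph \<Gamma> N)" by auto
  obtain u where u: "u \<in> pverts \<Gamma>" "(v, u) \<in> parcs \<Gamma> ^^ n" "N.orb u = C" using Suc.IH[OF C] by blast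
  obtain u' w' where "(u', w') \<in> parcs \<Gamma>" "C = N.orb u'" "B = N.orb w'"
    using CB by (auto simp: quotient_simps)
  then obtain w where "(u, w) \<in> parcs \<Gamma>" "N.orb w = B"
    using orb_neighbour u by metis
  with u show ?case using gr.in_arcsD2 by auto
qed

lemma connected_quotient: "Digraph_Component.connected (with_proj (quotient_graph \<Gamma> N))"
  by (simp add: N.quotient_graph_eq_image_graph[OF graph] connected_image_graph[OF graph conn])

text \<open>The lifted walk bounds the distance in \<open>\<Gamma>\<close> from above, and the image of a shortest walk in \<open>\<Gamma>\<close>
  bounds it from below.\<close>

lemma lift_sphere:
  assumes v: "v \<in> pverts \<Gamma>" and B: "B \<in> gsphere (quotient_graph \<Gamma> N) i (N.orb v)"
  obtains w where "w \<in> gsphere \<Gamma> i v" "N.orb w = B"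
proof -
  interpret Q: pair_graph "quotient_graph \<Gamma> N" by (rule pair_graph_quotient)
  have orb_v: "N.orb v \<in> pverts (quotient_graph \<Gamma> N)" using v by (simp add: quotient_simps)
  have "(N.orb v, B) \<in> parcs (quotient_graph \<Gamma> N) ^^ i"
    using Q.relpow_gdist[OF connected_quotient orb_v] B by (auto simp: gsphere_def)
  then obtain w where w: "w \<in> pverts \<Gamma>" "(v, w) \<in> parcs \<Gamma> ^^ i" "N.orb w = B"
    using lift_walk v by blast
  have "i \<le> gdist \<Gamma> v w"
  proof -
    obtain m where "m \<le> gdist \<Gamma> v w" "(N.orb v, B) \<in> parcs (quotient_graph \<Gamma> N) ^^ m"
      using image_graph_walk[OF gr.relpow_gdist[OF conn v w(1)], of N.orb] w(3)
      unfolding N.quotient_graph_eq_image_graph[OF graph] by blast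
    then show ?thesis using Q.gdist_le[OF orb_v, of B m] B by (simp add: gsphere_def)
  qed
  moreover have "gdist \<Gamma> v w \<le> i" using gr.gdist_le[OF v w(2)] .
  ultimately have "w \<in> gsphere \<Gamma> i v" using w by (simp add: gsphere_def)
  with w show thesis by (rule_tac that)
qed

text \<open>Two orbits at distance \<open>i\<close> from the orbit of \<open>v\<close> contain vertices at distance \<open>i\<close> from
  \<open>v\<close> itself; an element of \<open>G\<^sub>v\<close> that maps one vertex to the other induces the required permutation.
  Lifting also shows that the radii allowed in the quotient are allowed in \<open>\<Gamma>\<close>.\<close>

lemma LDT_quotient: "LDT_relative s (quotient_graph \<Gamma> N) (quotient_perms \<Gamma> G N)"
proof -
  let ?Q = "quotient_graph \<Gamma> N" and ?\<theta> = "orbit_perm \<Gamma> N"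
  have "(?\<theta> g A, ?\<theta> g B) \<in> parcs ?Q \<longleftrightarrow> (A, B) \<in> parcs ?Q"
    if g: "g \<in> G" and AB: "A \<in> pverts ?Q" "B \<in> pverts ?Q" for g A B
  proof -
    have arc: "(?\<theta> h A, ?\<theta> h B) \<in> parcs ?Q" if "h \<in> G" "(A, B) \<in> parcs ?Q" for h A B
    proof -
      obtain u v where uv: "(u, v) \<in> parcs \<Gamma>" "N.orb u \<noteq> N.orb v" "A = N.orb u" "B = N.orb v"
        using \<open>(A, B) \<in> parcs ?Q\<close> by (auto simp: quotient_simps)
      then have "u \<in> pverts \<Gamma>" "v \<in> pverts \<Gamma>" by (auto dest: gr.in_arcsD1 gr.in_arcsD2)
      with uv \<open>h \<in> G\<close> have "(h u, h v) \<in> parcs \<Gamma>" "N.orb (h u) \<noteq> N.orb (h v)"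
          "?\<theta> h A = N.orb (h u)" "?\<theta> h B = N.orb (h v)"
        by (simp_all add: arc_perm orb_eq_perm orbit_perm_orb)
      then show ?thesis unfolding quotient_simps by blast
    qed
    let ?i = "inv\<^bsub>perm_group \<Gamma> G\<^esub> g"
    have "?\<theta> ?i (?\<theta> g C) = C" if "C \<in> pverts ?Q" for C
      using that g
      by (auto simp: quotient_simps orbit_perm_orb perm_closed perm_inv perm_inv_closed
          simp del: orbit_hom.hom_inv)
    then show ?thesis using arc[OF g] arc[OF perm_inv_closed[OF g], of "?\<theta> g A" "?\<theta> g B"] AB by auto
  qed
  then have "subgroup (quotient_perms \<Gamma> G N) (Aut ?Q)"
    by (simp add: subgroup_Aut_iff quotient_perms_eq subgroup_orbit_perms)
  moreover have "\<exists>h \<in> stabilizer (perm_group ?Q (quotient_perms \<Gamma> G N)) (\<lambda>g. g) A. h X = Y"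
    if A: "A \<in> pverts ?Q" and i: "i \<in> {1..min s (diam ?Q)}"
      and XY: "X \<in> gsphere ?Q i A" "Y \<in> gsphere ?Q i A" for A i X Y
  proof -
    obtain v where v: "v \<in> pverts \<Gamma>" "A = N.orb v" using A by (auto simp: quotient_simps)
    obtain x where x: "x \<in> gsphere \<Gamma> i v" "N.orb x = X" using lift_sphere[OF v(1)] XY(1) v(2) by metis
    obtain y where y: "y \<in> gsphere \<Gamma> i v" "N.orb y = Y" using lift_sphere[OF v(1)] XY(2) v(2) by metis
    obtain g where g: "g \<in> G" "g v = v" "g x = y"
      using stabilizer_transitive[OF v(1) _ _ x(1) y(1)] i by auto
    have "x \<in> pverts \<Gamma>" using x by (simp add: gsphere_def)
    with g v x y have "?\<theta> g A = A" "?\<theta> g X = Y" using orbit_perm_orb[OF g(1)] by metis+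
    then show ?thesis
      using g(1) by (auto simp: stabilizer_def quotient_perms_eq)
  qed
  ultimately show ?thesis
    using pair_graph_quotient connected_quotient
    by (simp add: LDT_relative_def locally_distance_transitive_def)
qed

end

section \<open>Covers and complete multipartite graphs\<close>

context ldt_normal
begin

text \<open>If one neighbour of a vertex lies in the orbit of that vertex, all of them do, since the
  stabiliser is transitive on neighbours and fixes the orbit. By connectedness this orbit is then
  everything, and the quotient is \<open>K\<^sub>1\<close>.\<close>

lemma arc_between_orbits:
  assumes s: "1 \<le> s" and nd: "\<not> degenerate (quotient_graph \<Gamma> N)" and uv: "(u, v) \<in> parcs \<Gamma>"
  shows "N.orb u \<noteq> N.orb v"
proof
  assume eq: "N.orb u = N.orb v"
  note u = gr.in_arcsD1[OF uv]
  have closed: "N.orb y = N.orb u" if xy: "(x, y) \<in> parcs \<Gamma>" and x: "N.orb x = N.orb u" for x y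
  proof -
    note xV = gr.in_arcsD1[OF xy]
    obtain z where z: "(x, z) \<in> parcs \<Gamma>" "N.orb z = N.orb v" using orb_neighbour[OF xV x uv] .
    have "z \<in> gsphere \<Gamma> 1 x" "y \<in> gsphere \<Gamma> 1 x"
      using z xy gr.gsphere_1[OF conn xV] by auto
    then obtain g where g: "g \<in> G" "g x = x" "g z = y"
      using stabilizer_transitive[OF xV order_refl s] by blast
    have "N.orb z = N.orb x" using z x eq by simp
    then have "N.orb (g z) = N.orb (g x)"
      using orb_eq_perm[OF g(1) gr.in_arcsD2[OF z(1)] xV] by blast
    with g x show ?thesis by simp
  qed
  have "N.orb x = N.orb u" if x: "x \<in> pverts \<Gamma>" for x
  proof -
    obtain n where "(u, x) \<in> parcs \<Gamma> ^^ n" using connecting_walk[OF u x] .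
    then show ?thesis
    proof (induction n arbitrary: x)
      case (Suc n)
      then obtain y where "(u, y) \<in> parcs \<Gamma> ^^ n" "(y, x) \<in> parcs \<Gamma>" by auto
      with Suc.IH closed show ?case by blast
    qed simp
  qed
  then have one: "pverts (quotient_graph \<Gamma> N) = {N.orb u}"
    unfolding quotient_simps using u by blast
  interpret Q: pair_graph "quotient_graph \<Gamma> N" by (rule pair_graph_quotient)
  have "(A, B) \<notin> parcs (quotient_graph \<Gamma> N)" for A B
    using Q.in_arcsD1[of A B] Q.in_arcsD2[of A B] Q.no_loops'[of A B] unfolding one by blast
  then have "parcs (quotient_graph \<Gamma> N) = {}" by auto
  with one have "degenerate (quotient_graph \<Gamma> N)"
    by (simp add: degenerate_iff_star[OF pair_graph_quotient])
  with nd show False by blast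
qed

lemma same_orbit_of_common_neighbour:
  assumes "1 \<le> s" "(a, b) \<in> parcs \<Gamma>" "(b, c) \<in> parcs \<Gamma>"
  shows "orb a = orb c"
proof -
  note V = gr.in_arcsD1[OF assms(2)] gr.in_arcsD2[OF assms(2)]
  have "a \<in> gsphere \<Gamma> 1 b" "c \<in> gsphere \<Gamma> 1 b"
    using assms gr.gsphere_1[OF conn V(2)] gr.arcs_symmetric by auto
  then obtain g where "g \<in> G" "g a = c"
    using stabilizer_transitive[OF V(2) order_refl assms(1)] by blast
  then show ?thesis using orb_perm V by metis
qed

text \<open>In general \<open>G\<close> may have two vertex orbits, the parts of a bipartition. The triangle rules
  this out: any two vertices joined by a walk of length 2 are equivalent, and the three vertices of the
  triangle are equivalent to each other, so the equivalence spreads along every walk from \<open>a\<close>.\<close>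

lemma vertex_transitive_of_triangle:
  assumes s: "1 \<le> s" and tri: "(a, b) \<in> parcs \<Gamma>" "(b, c) \<in> parcs \<Gamma>" "(c, a) \<in> parcs \<Gamma>"
    and x: "x \<in> pverts \<Gamma>"
  shows "orb x = orb a"
proof -
  note common = same_orbit_of_common_neighbour[OF s]
  have ab: "orb a = orb b"
    using common[OF gr.arcs_symmetric[OF tri(3)] gr.arcs_symmetric[OF tri(2)]] .
  obtain n where "(a, x) \<in> parcs \<Gamma> ^^ n" using connecting_walk[OF gr.in_arcsD1[OF tri(1)] x] .
  then have "orb x = orb a \<and> (\<forall>y. (x, y) \<in> parcs \<Gamma> \<longrightarrow> orb y = orb a)"
  proof (induction n arbitrary: x)
    case 0
    then show ?case using common[OF gr.arcs_symmetric tri(1)] ab by simp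
  next
    case (Suc n)
    then obtain y where "(a, y) \<in> parcs \<Gamma> ^^ n" and yx: "(y, x) \<in> parcs \<Gamma>" by auto
    with Suc.IH have "orb y = orb a" "\<forall>z. (y, z) \<in> parcs \<Gamma> \<longrightarrow> orb z = orb a" by blast+
    with yx show ?case using common by blast
  qed
  then show ?thesis ..
qed

text \<open>This says \<open>\<Gamma>\<^sub>2(z) \<subseteq> z\<^sup>N\<close> without mentioning distances: a walk of length 2 from \<open>z\<close> that
  leaves the orbit of \<open>z\<close> has a shortcut of length 1.\<close>

definition sphere_2_in_orbit :: "'a \<Rightarrow> bool" where
  "sphere_2_in_orbit z \<longleftrightarrow>
     (\<forall>y x. (z, y) \<in> parcs \<Gamma> \<longrightarrow> (y, x) \<in> parcs \<Gamma> \<longrightarrow> N.orb x \<noteq> N.orb z \<longrightarrow> (z, x) \<in> parcs \<Gamma>)"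

lemma sphere_2_in_orbitD:
  "sphere_2_in_orbit z \<Longrightarrow> (z, y) \<in> parcs \<Gamma> \<Longrightarrow> (y, x) \<in> parcs \<Gamma> \<Longrightarrow> N.orb x \<noteq> N.orb z \<Longrightarrow>
     (z, x) \<in> parcs \<Gamma>"
  unfolding sphere_2_in_orbit_def by blast

text \<open>This is where distance transitivity at radius 2 enters: \<open>w'\<close> is a vertex of \<open>\<Gamma>\<^sub>2(w)\<close> in the
  orbit of \<open>w\<close>, and the stabiliser of \<open>w\<close> moves it to every other vertex of \<open>\<Gamma>\<^sub>2(w)\<close>.\<close>

lemma sphere_2_in_orbitI:
  assumes s: "2 \<le> s" and nd: "\<not> degenerate (quotient_graph \<Gamma> N)"
    and w: "(v, w) \<in> parcs \<Gamma>" and w': "(v, w') \<in> parcs \<Gamma>" "w \<noteq> w'" "N.orb w = N.orb w'"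
  shows "sphere_2_in_orbit w"
  unfolding sphere_2_in_orbit_def
proof (intro allI impI)
  fix y x assume yx: "(w, y) \<in> parcs \<Gamma>" "(y, x) \<in> parcs \<Gamma>" "N.orb x \<noteq> N.orb w"
  note wV = gr.in_arcsD2[OF w] and w'V = gr.in_arcsD2[OF w'(1)] and xV = gr.in_arcsD2[OF yx(2)]
  show "(w, x) \<in> parcs \<Gamma>"
  proof (rule ccontr)
    assume "(w, x) \<notin> parcs \<Gamma>"
    moreover have "w \<noteq> x" using yx by blast
    ultimately have "gdist \<Gamma> w x = 2" using gr.gdist_eq_2[OF conn yx(1,2)] by blast
    moreover have "(w, w') \<notin> parcs \<Gamma>" using arc_between_orbits[OF _ nd, of w w'] s w' by auto
    then have "gdist \<Gamma> w w' = 2"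
      using gr.gdist_eq_2[OF conn gr.arcs_symmetric[OF w] w'(1)] w' by blast
    ultimately have "w' \<in> gsphere \<Gamma> 2 w" "x \<in> gsphere \<Gamma> 2 w"
      using w'V xV by (auto simp: gsphere_def)
    then obtain g where g: "g \<in> G" "g w = w" "g w' = x"
      using stabilizer_transitive[OF wV one_le_numeral s] by blast
    then have "N.orb x = N.orb w" using orb_eq_perm[OF g(1) wV w'V] w' by simp
    with yx show False by blast
  qed
qed

lemma sphere_2_in_orbit_perm:
  assumes g: "g \<in> G" and z: "z \<in> pverts \<Gamma>" and "sphere_2_in_orbit z"
  shows "sphere_2_in_orbit (g z)"
  unfolding sphere_2_in_orbit_def
proof (intro allI impI)
  let ?i = "inv\<^bsub>perm_group \<Gamma> G\<^esub> g"
  note i = perm_inv_closed[OF g]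
  fix y x assume yx: "(g z, y) \<in> parcs \<Gamma>" "(y, x) \<in> parcs \<Gamma>" "N.orb x \<noteq> N.orb (g z)"
  note V = gr.in_arcsD1[OF yx(1)] gr.in_arcsD1[OF yx(2)] gr.in_arcsD2[OF yx(2)]
  have "(z, ?i y) \<in> parcs \<Gamma>" "(?i y, ?i x) \<in> parcs \<Gamma>" "N.orb (?i x) \<noteq> N.orb z"
    using arc_perm[OF i V(1,2)] arc_perm[OF i V(2,3)] orb_eq_perm[OF i V(3,1)] yx
      perm_inv(1)[OF g z] by auto
  then have "(z, ?i x) \<in> parcs \<Gamma>" using assms(3) sphere_2_in_orbitD by blast
  then have "(?i (g z), ?i x) \<in> parcs \<Gamma>" by (simp add: perm_inv(1)[OF g z])
  then show "(g z, x) \<in> parcs \<Gamma>" using arc_perm[OF i V(1,3)] by blast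
qed

text \<open>By induction along a walk from \<open>w\<close>: a translate of each step starts at \<open>w\<close> or at a neighbour
  of \<open>w\<close>, and in the second case the resulting walk of length 2 has a shortcut unless it returns to
  the orbit of \<open>w\<close>.\<close>

lemma neighbour_in_every_orbit:
  assumes w: "w \<in> pverts \<Gamma>" "sphere_2_in_orbit w" and x: "x \<in> pverts \<Gamma>" "N.orb x \<noteq> N.orb w"
  obtains x' where "(w, x') \<in> parcs \<Gamma>" "N.orb x' = N.orb x"
proof -
  obtain n where "(w, x) \<in> parcs \<Gamma> ^^ n" using connecting_walk[OF w(1) x(1)] .
  then have "N.orb x = N.orb w \<or> (\<exists>x'. (w, x') \<in> parcs \<Gamma> \<and> N.orb x' = N.orb x)"
  proof (induction n arbitrary: x)
    case 0
    then show ?case by simp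
  next
    case (Suc n)
    then obtain y where y: "(y, x) \<in> parcs \<Gamma>"
      and IH: "N.orb y = N.orb w \<or> (\<exists>y'. (w, y') \<in> parcs \<Gamma> \<and> N.orb y' = N.orb y)" by auto
    from IH show ?case
    proof
      assume "N.orb y = N.orb w"
      then show ?thesis using orb_neighbour[OF w(1) _ y] by metis
    next
      assume "\<exists>y'. (w, y') \<in> parcs \<Gamma> \<and> N.orb y' = N.orb y"
      then obtain y' where y': "(w, y') \<in> parcs \<Gamma>" "N.orb y' = N.orb y" by blast
      obtain x' where "(y', x') \<in> parcs \<Gamma>" "N.orb x' = N.orb x"
        using orb_neighbour[OF gr.in_arcsD2[OF y'(1)] y'(2) y] .
      then show ?thesis using sphere_2_in_orbitD[OF w(2) y'(1)] by metis
    qed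
  qed
  with x that show thesis by blast
qed

text \<open>The dichotomy behind the theorem: two neighbours of one vertex in a common orbit force
  \<open>\<Gamma>\<close> to be complete multipartite, with the \<open>N\<close>-orbits as parts.\<close>

lemma cover_or_complete_multipartite:
  assumes s: "2 \<le> s" and nd: "\<not> degenerate (quotient_graph \<Gamma> N)"
    and not_cover: "\<not> covers_quotient \<Gamma> N"
  shows "\<exists>m \<ge> 3. \<exists>b \<ge> 2. complete_multipartite_graph m b \<Gamma>"
proof -
  let ?Q = "quotient_graph \<Gamma> N"
  have s1: "1 \<le> s" using s by simp
  note cross = arc_between_orbits[OF s1 nd]
  obtain B1 B2 v where B: "(B1, B2) \<in> parcs ?Q" and vB: "v \<in> B1"
    and card: "card (gsphere \<Gamma> 1 v \<inter> B2) \<noteq> 1"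
    using not_cover by (auto simp: covers_quotient_def)
  obtain u0 w0 where u0w0: "(u0, w0) \<in> parcs \<Gamma>" "B1 = N.orb u0" "B2 = N.orb w0"
    using B by (auto simp: quotient_simps)
  note u0 = gr.in_arcsD1[OF u0w0(1)] and w0 = gr.in_arcsD2[OF u0w0(1)]
  have v: "v \<in> pverts \<Gamma>" using vB N.orb_subset[OF u0] u0w0 by blast
  have "N.orb v = N.orb u0" using N.orb_eq_iff[OF u0 v] vB u0w0 by simp
  then obtain w where w: "(v, w) \<in> parcs \<Gamma>" "N.orb w = B2"
    using orb_neighbour[OF v _ u0w0(1)] u0w0(3) by metis
  note wV = gr.in_arcsD2[OF w(1)]
  have "w \<in> gsphere \<Gamma> 1 v \<inter> B2" using w gr.gsphere_1[OF conn v] N.orb_self[OF wV] by auto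
  moreover have "gsphere \<Gamma> 1 v \<inter> B2 \<noteq> {w}" using card by (metis is_singletonI is_singleton_altdef)
  ultimately obtain w' where "w' \<in> gsphere \<Gamma> 1 v \<inter> B2" "w' \<noteq> w" by blast
  then have w': "(v, w') \<in> parcs \<Gamma>" "w \<noteq> w'" "w' \<in> N.orb w"
    using gr.gsphere_1[OF conn v] w by auto
  note w'V = gr.in_arcsD2[OF w'(1)]
  have "N.orb w = N.orb w'" using N.orb_eq_iff[OF wV w'V] w'(3) by simp
  then have sph_w: "sphere_2_in_orbit w" using sphere_2_in_orbitI[OF s nd w(1) w'(1,2)] by blast
  \<comment> \<open>The orbit of \<open>w\<close> is adjacent to all others; without a further edge the quotient would be a star.\<close>
  have "\<exists>C D. (C, D) \<in> parcs ?Q \<and> C \<noteq> N.orb w \<and> D \<noteq> N.orb w"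
  proof (rule ccontr)
    assume no: "\<not> ?thesis"
    interpret Q: pair_graph ?Q by (rule pair_graph_quotient)
    have leaf: "(N.orb w, C) \<in> parcs ?Q" if C: "C \<in> pverts ?Q" "C \<noteq> N.orb w" for C
    proof -
      obtain x where x: "x \<in> pverts \<Gamma>" "C = N.orb x" using C by (auto simp: quotient_simps)
      then obtain x' where "(w, x') \<in> parcs \<Gamma>" "N.orb x' = N.orb x"
        using neighbour_in_every_orbit[OF wV sph_w] C(2) by blast
      with C x show ?thesis unfolding quotient_simps by (intro CollectI exI[of _ w] exI[of _ x']) simp
    qed
    have "parcs ?Q = {N.orb w} \<times> (pverts ?Q - {N.orb w}) \<union> (pverts ?Q - {N.orb w}) \<times> {N.orb w}"
      (is "_ = ?R")
    proof (intro equalityI subsetI)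
      fix e assume e: "e \<in> parcs ?Q"
      obtain A C where AC: "e = (A, C)" by (cases e)
      with e have "A \<noteq> C" "A \<in> pverts ?Q" "C \<in> pverts ?Q" "A = N.orb w \<or> C = N.orb w"
        using no Q.no_loops' Q.in_arcsD1 Q.in_arcsD2 by blast+
      then show "e \<in> ?R" unfolding AC by blast
    next
      fix e assume "e \<in> ?R"
      then obtain C where "C \<in> pverts ?Q" "C \<noteq> N.orb w" "e = (N.orb w, C) \<or> e = (C, N.orb w)" by auto
      then show "e \<in> parcs ?Q" using leaf Q.arcs_symmetric by blast
    qed
    moreover have "N.orb w \<in> pverts ?Q" using wV by (simp add: quotient_simps)
    ultimately show False using nd degenerate_iff_star[OF pair_graph_quotient] by blast
  qed
  then obtain c0 d0 where c0d0: "(c0, d0) \<in> parcs \<Gamma>" "N.orb c0 \<noteq> N.orb w" "N.orb d0 \<noteq> N.orb w"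
    by (auto simp: quotient_simps)
  \<comment> \<open>Translate the edge between the two further orbits so that it closes a triangle at \<open>w\<close>.\<close>
  obtain c where c: "(w, c) \<in> parcs \<Gamma>" "N.orb c = N.orb c0"
    using neighbour_in_every_orbit[OF wV sph_w gr.in_arcsD1[OF c0d0(1)] c0d0(2)] .
  obtain d where d: "(c, d) \<in> parcs \<Gamma>" "N.orb d = N.orb d0"
    using orb_neighbour[OF gr.in_arcsD2[OF c(1)] c(2) c0d0(1)] .
  have dw: "(d, w) \<in> parcs \<Gamma>"
    using sphere_2_in_orbitD[OF sph_w c(1) d(1)] d c0d0 gr.arcs_symmetric by simp
  have wcd: "{N.orb w, N.orb c, N.orb d} \<subseteq> N.orb ` pverts \<Gamma>"
      "N.orb w \<noteq> N.orb c" "N.orb c \<noteq> N.orb d" "N.orb d \<noteq> N.orb w"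
    using cross c(1) d(1) dw gr.in_arcsD1[OF c(1)] gr.in_arcsD1[OF d(1)] gr.in_arcsD1[OF dw] by auto
  have trans: "\<exists>g \<in> G. g w = x" if x: "x \<in> pverts \<Gamma>" for x
    using vertex_transitive_of_triangle[OF s1 c(1) d(1) dw x] orbE[OF wV x] by metis
  then have sph: "sphere_2_in_orbit x" if "x \<in> pverts \<Gamma>" for x
    using that sphere_2_in_orbit_perm[OF _ wV sph_w] by blast
  have step: "(u, x) \<in> parcs \<Gamma>"
    if "(u, y) \<in> parcs \<Gamma>" "(y, x) \<in> parcs \<Gamma>" "N.orb x \<noteq> N.orb u" for u y x
    using that sphere_2_in_orbitD[OF sph] gr.in_arcsD1 by blast
  \<comment> \<open>A walk that returns to the orbit of \<open>u\<close> after two steps and then leaves it also has a shortcut.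
    Its end \<open>x\<close> may lie in the orbit of \<open>t\<close>, and then \<open>z\<close> in a third orbit is adjacent to
    \<open>u\<close>, \<open>t\<close>, \<open>y\<close> and finally to \<open>x\<close>.\<close>
  have three_steps: "(u, x) \<in> parcs \<Gamma>"
    if ut: "(u, t) \<in> parcs \<Gamma>" and ty: "(t, y) \<in> parcs \<Gamma>" and yx: "(y, x) \<in> parcs \<Gamma>"
      and uy: "N.orb y = N.orb u" for u t y x
  proof -
    have ne: "N.orb x \<noteq> N.orb u" "N.orb t \<noteq> N.orb u" using cross ut yx uy by metis+
    obtain z0 where z0: "z0 \<in> {w, c, d}" "N.orb z0 \<noteq> N.orb t" "N.orb z0 \<noteq> N.orb u"
      using wcd by (metis insertCI)
    then have "z0 \<in> pverts \<Gamma>" using gr.in_arcsD1 c(1) d(1) dw by blast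
    then obtain z where z: "(t, z) \<in> parcs \<Gamma>" "N.orb z = N.orb z0"
      using neighbour_in_every_orbit[OF gr.in_arcsD2[OF ut] sph[OF gr.in_arcsD2[OF ut]] _ z0(2)] by blast
    have uz: "(u, z) \<in> parcs \<Gamma>" and yz: "(y, z) \<in> parcs \<Gamma>"
      using step[OF ut z(1)] step[OF gr.arcs_symmetric[OF ty] z(1)] z z0 uy by simp_all
    show ?thesis
    proof (cases "N.orb x = N.orb t")
      case True
      then have "(x, z) \<in> parcs \<Gamma>" using step[OF gr.arcs_symmetric[OF yx] yz] z z0 by simp
      then show ?thesis using step[OF uz gr.arcs_symmetric] ne by blast
    next
      case False
      then have "(t, x) \<in> parcs \<Gamma>" using step[OF ty yx] by blast
      then show ?thesis using step[OF ut] ne by blast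
    qed
  qed
  have complete: "(u, x) \<in> parcs \<Gamma>" if u: "u \<in> pverts \<Gamma>" and x: "x \<in> pverts \<Gamma>"
    and "N.orb u \<noteq> N.orb x" for u x
  proof -
    obtain n where "(u, x) \<in> parcs \<Gamma> ^^ n" using connecting_walk[OF u x] .
    \<comment> \<open>The second conjunct keeps the walk that \<open>three_steps\<close> needs.\<close>
    then have "(N.orb x \<noteq> N.orb u \<longrightarrow> (u, x) \<in> parcs \<Gamma>) \<and>
        (N.orb x = N.orb u \<longrightarrow> x = u \<or> (\<exists>t. (u, t) \<in> parcs \<Gamma> \<and> (t, x) \<in> parcs \<Gamma>))"
    proof (induction n arbitrary: x)
      case 0
      then show ?case by simp
    next
      case (Suc n)
      then obtain y where yx: "(y, x) \<in> parcs \<Gamma>"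
        and IH: "N.orb y \<noteq> N.orb u \<longrightarrow> (u, y) \<in> parcs \<Gamma>"
          "N.orb y = N.orb u \<longrightarrow> y = u \<or> (\<exists>t. (u, t) \<in> parcs \<Gamma> \<and> (t, y) \<in> parcs \<Gamma>)"
        by auto
      show ?case
      proof (cases "N.orb y = N.orb u")
        case True
        then have "(u, x) \<in> parcs \<Gamma>" using IH(2) yx three_steps by blast
        moreover have "N.orb x \<noteq> N.orb u" using cross[OF yx] True by simp
        ultimately show ?thesis by blast
      next
        case False
        then have "(u, y) \<in> parcs \<Gamma>" using IH(1) by blast
        then show ?thesis using step yx by blast
      qed
    qed
    with that show ?thesis by metis
  qed
  let ?P = "N.orb ` pverts \<Gamma>"
  have fin: "finite (pverts \<Gamma>)" by (rule gr.pair_finite_verts)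
  have "card {N.orb w, N.orb c, N.orb d} = 3" using wcd by auto
  then have "3 \<le> card ?P" using card_mono[OF finite_imageI[OF fin] wcd(1)] by simp
  moreover have "2 \<le> card (N.orb w)"
  proof -
    have "{w, w'} \<subseteq> N.orb w" using w'(3) N.orb_self[OF wV] by blast
    from card_mono[OF finite_subset[OF N.orb_subset[OF wV] fin] this] w'(2) show ?thesis by simp
  qed
  moreover have "complete_multipartite_graph (card ?P) (card (N.orb w)) \<Gamma>"
    unfolding complete_multipartite_graph_def
  proof (intro conjI exI[of _ ?P] ballI refl graph)
    show "partition_on (pverts \<Gamma>) ?P"
    proof (rule partition_onI)
      show "\<Union> ?P = pverts \<Gamma>" using N.orb_self N.orb_subset by blast
      show "disjnt p q" if pq: "p \<in> ?P" "q \<in> ?P" "p \<noteq> q" for p q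
      proof -
        obtain a b where ab: "a \<in> pverts \<Gamma>" "b \<in> pverts \<Gamma>" "p = N.orb a" "q = N.orb b"
          using pq by blast
        have "N.orb a = N.orb b" if x: "x \<in> N.orb a" "x \<in> N.orb b" for x
        proof -
          have "x \<in> pverts \<Gamma>" using x(1) N.orb_subset[OF ab(1)] by blast
          with x ab N.orb_eq_iff show ?thesis by metis
        qed
        with ab \<open>p \<noteq> q\<close> show ?thesis unfolding disjnt_def by blast
      qed
      show "{} \<notin> ?P" using N.orb_self by blast
    qed
    show "card B = card (N.orb w)" if B: "B \<in> ?P" for B
    proof -
      obtain x where "x \<in> pverts \<Gamma>" "B = N.orb x" using B by blast
      moreover from this obtain g where g: "g \<in> G" "g w = x" using trans by blast
      ultimately have "B = g ` N.orb w" using image_orb[OF g(1) wV] by simp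
      then show ?thesis
        using card_image[OF inj_on_subset[OF perm_inj[OF g(1)] N.orb_subset[OF wV]]] by simp
    qed
    show "parcs \<Gamma> = {(u, v). \<exists>B \<in> ?P. \<exists>C \<in> ?P. B \<noteq> C \<and> u \<in> B \<and> v \<in> C}" (is "_ = ?R")
    proof (intro equalityI subsetI)
      fix e assume e: "e \<in> parcs \<Gamma>"
      obtain u v where uv: "e = (u, v)" by (cases e)
      have "u \<in> pverts \<Gamma>" "v \<in> pverts \<Gamma>" "N.orb u \<noteq> N.orb v"
        using e cross gr.in_arcsD1 gr.in_arcsD2 unfolding uv by blast+
      then show "e \<in> ?R" unfolding uv using N.orb_self by blast
    next
      fix e assume "e \<in> ?R"
      then obtain u v a b where e: "e = (u, v)" and ab: "a \<in> pverts \<Gamma>" "b \<in> pverts \<Gamma>"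
        "N.orb a \<noteq> N.orb b" "u \<in> N.orb a" "v \<in> N.orb b" by blast
      then have V: "u \<in> pverts \<Gamma>" "v \<in> pverts \<Gamma>" using N.orb_subset by blast+
      then have "N.orb u = N.orb a" "N.orb v = N.orb b" using ab N.orb_eq_iff by metis+
      with ab(3) have "N.orb u \<noteq> N.orb v" by simp
      with V complete show "e \<in> parcs \<Gamma>" unfolding e by blast
    qed
  qed
  ultimately show ?thesis by blast
qed

end

section \<open>Basic quotients\<close>

theorem theorem1p2:
  fixes s :: nat
    and \<Gamma> :: "'a pair_pre_digraph"
    and G :: "('a \<Rightarrow> 'a) set"
  assumes "s \<ge> 2"
    and "LDT_relative s \<Gamma> G"
    and "\<not> degenerate \<Gamma>"
    and "\<not> G_basic \<Gamma> G"
    and "\<not> (\<exists>m \<ge> 3. \<exists>b \<ge> 2. complete_multipartite_graph m b \<Gamma>)"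
  shows "\<exists>N. nontrivial_normal \<Gamma> G N \<and>
           covers_quotient \<Gamma> N \<and>
           faithful_action (perm_group \<Gamma> G Mod N) (pverts (quotient_graph \<Gamma> N))
             (quotient_action \<Gamma> N) \<and>
           LDT_relative s (quotient_graph \<Gamma> N) (quotient_perms \<Gamma> G N) \<and>
           G_basic (quotient_graph \<Gamma> N) (quotient_perms \<Gamma> G N)"
proof -
  have graph: "pair_graph \<Gamma>" and "subgroup G (Aut \<Gamma>)"
    using assms(2) by (auto simp: LDT_relative_def locally_distance_transitive_def)
  then interpret permutation_group \<Gamma> G by (simp add: permutation_group_def subgroup_Aut_iff)
  let ?S = "{N. nontrivial_normal \<Gamma> G N \<and> \<not> degenerate (quotient_graph \<Gamma> N)}"
  have "finite (pverts \<Gamma>)"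
    using graph by (simp add: pair_graph_def pair_digraph_def pair_fin_digraph.pair_finite_verts)
  then have "finite (Pow G)" using finite_perms by simp
  moreover have "?S \<subseteq> Pow G"
    using normal_imp_subgroup[THEN subgroup.subset] by (fastforce simp: nontrivial_normal_def)
  ultimately have "finite ?S" by (metis finite_subset)
  moreover have "?S \<noteq> {}" using assms(3,4) by (auto simp: G_basic_def)
  ultimately obtain N where "N \<in> ?S" and max: "\<And>M. M \<in> ?S \<Longrightarrow> N \<subseteq> M \<Longrightarrow> N = M"
    using finite_has_maximal[of ?S] by blast
  then have nt: "nontrivial_normal \<Gamma> G N" and nd: "\<not> degenerate (quotient_graph \<Gamma> N)" by auto
  interpret ldt_normal \<Gamma> G N s
    using nt graph assms(2) subgroup_BijGroup
    by (simp add: ldt_normal_def ldt_normal_axioms_def normal_perms_def normal_perms_axioms_def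
        permutation_group_def nontrivial_normal_def)
  have maximal: "M = N"
    if M: "M \<lhd> perm_group \<Gamma> G" "N \<subseteq> M" "\<not> degenerate (quotient_graph \<Gamma> M)" for M
  proof -
    have "M \<noteq> {\<one>\<^bsub>perm_group \<Gamma> G\<^esub>}"
      using M(2) nt N.perm_id by (auto simp: nontrivial_normal_def)
    with M have "M \<in> ?S" by (simp add: nontrivial_normal_def)
    with max M show ?thesis by blast
  qed
  let ?Q = "quotient_graph \<Gamma> N"
  have "kernel (perm_group \<Gamma> G) (BijGroup (pverts ?Q)) (orbit_perm \<Gamma> N) = N"
    using quotient_graph_kernel nd by (intro maximal) auto
  then have "faithful_action (perm_group \<Gamma> G Mod N) (pverts ?Q) (quotient_action \<Gamma> N)"
    by (rule faithful_quotient_action)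
  moreover have "covers_quotient \<Gamma> N"
    using cover_or_complete_multipartite[OF assms(1) nd] assms(5) by blast
  moreover have "G_basic ?Q (quotient_perms \<Gamma> G N)"
    unfolding G_basic_def
  proof (intro conjI allI impI nd)
    fix N' assume N': "nontrivial_normal ?Q (quotient_perms \<Gamma> G N) N'"
    then have normal': "N' \<lhd> perm_group ?Q (orbit_perm \<Gamma> N ` G)"
      by (simp add: nontrivial_normal_def quotient_perms_eq)
    show "degenerate (quotient_graph ?Q N')"
    proof (rule ccontr)
      assume "\<not> degenerate (quotient_graph ?Q N')"
      then have *: "{g \<in> G. orbit_perm \<Gamma> N g \<in> N'} = N"
        using preimage_normal[OF normal'] by (intro maximal) auto
      have sub: "N' \<subseteq> orbit_perm \<Gamma> N ` G"
        using subgroup.subset[OF normal_imp_subgroup[OF normal']] by simp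
      have one: "\<one>\<^bsub>perm_group ?Q (orbit_perm \<Gamma> N ` G)\<^esub> \<in> N'"
        using subgroup.one_closed[OF normal_imp_subgroup[OF normal']] .
      have "n' = \<one>\<^bsub>perm_group ?Q (orbit_perm \<Gamma> N ` G)\<^esub>" if "n' \<in> N'" for n'
      proof -
        obtain g where g: "g \<in> G" "n' = orbit_perm \<Gamma> N g" using sub \<open>n' \<in> N'\<close> by blast
        with \<open>n' \<in> N'\<close> have "g \<in> N" using * by blast
        then show ?thesis using orbit_perm_N g(2) by (simp add: BijGroup_def)
      qed
      then have "N' = {\<one>\<^bsub>perm_group ?Q (orbit_perm \<Gamma> N ` G)\<^esub>}" using one by blast
      then show False using N' by (simp add: nontrivial_normal_def)
    qed
  qed
  ultimately show ?thesis using nt LDT_quotient by blast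
qed

end
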